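(* Let $n\equiv 1 \pmod 4$ be a positive integer and let $M=(n-1)/4$ or $M=n-1$. Define \[B(n,q)=\frac{(n^2-1)(1-q)^2}{24}+\sum_{k=1}^{(n-1)/4}\frac{q^{4k-2}}{[4k-2]^2}.\] Then, modulo $[n]\Phi_n(q)^3$, \[\sum_{k=0}^{M}[8 k+1] \frac{(q ; q^{4})_k^4}{(q^{4} ; q^{4})_k^{4}} q^{2k} \equiv\frac{\left(q^{2 } ; q^{4}\right)_{(n-1) / 4}}{\left(q^{4} ; q^{4}\right)_{(n-1) / 4}}[n] q^{(1-n) / 4}\big\{1+[n]^2B(n,q)\big\},\] and \[\sum_{k=0}^{M}[8k+1]_{q^{2}}[8k+1]^{2} \frac{\left(q^{2} ; q^{8}\right)_{k}^{4}}{\left(q^{8} ; q^{8}\right)_{k}^{4}} q^{-4k } \equiv -\frac{2[n]_{q^{2}}(q^{4};q^{8})_{(n-1)/4}}{(1+q^{2})(q^{8};q^{8})_{(n-1)/4}}q^{(5-n)/2}\big\{1+[n]_{q^2}^2B(n,q^2)\big\}.\]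
   Context: $(a;q)_m=(1-a)(1-aq)\cdots(1-aq^{m-1})$ (with $(a;q)_0=1$) is the $q$-shifted factorial, and $(a_1,\dots,a_r;q)_m=(a_1;q)_m\cdots(a_r;q)_m$. The $q$-integer is $[m]=[m]_q=(1-q^m)/(1-q)$, and $[m]_{q^2}=(1-q^{2m})/(1-q^2)$. $\Phi_n(q)$ denotes the $n$-th cyclotomic polynomial. A congruence $A(q)\equiv C(q)\pmod{P(q)}$ between rational functions means that the numerator of the reduced difference $A-C$ is divisible by the polynomial $P(q)$ while its denominator is coprime to $P(q)$.
   Formalization: In the second congruence the exponent (5-n)/2 is corrected to (3-n)/2 (the printed one fails, e.g. for n=5), and n>1 is required there, since for n=1 the modulus is (q-1)^3 while at q=1 the two sides are 1 and -1. *)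

theory Defs
  imports
    "HOL-Analysis.Analysis"
    "HOL-Number_Theory.Cong"
    "HOL-Computational_Algebra.Computational_Algebra"
    "HOL-Computational_Algebra.Field_as_Ring"
begin

text \<open>
  Rational functions in the indeterminate \<open>q\<close> are elements of \<^typ>\<open>complex poly fract\<close>.
  Complex coefficients let the cyclotomic polynomial be defined by its roots; gcds,
  divisibility and coprimality of rational polynomials do not change under this extension
  of the coefficient field.
\<close>

definition qvar :: "complex poly fract" where
  "qvar = to_fract [:0, 1:]"

definition qpoch :: "'a::comm_ring_1 \<Rightarrow> 'a \<Rightarrow> nat \<Rightarrow> 'a" where
  "qpoch a q m = (\<Prod>i<m. (1 - a * q ^ i))"

text \<open>
  The type class covers both rational functions, where \<open>div\<close> is field division, and
  polynomials, where the division is exact; the latter is needed for \<open>[n]\<close> as a modulus.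
\<close>

definition qint :: "'a::idom_divide \<Rightarrow> nat \<Rightarrow> 'a" where
  "qint q m = (1 - q ^ m) div (1 - q)"

definition cyclotomic :: "nat \<Rightarrow> complex poly" where
  "cyclotomic n =
     (\<Prod>k | k \<in> {1..n} \<and> coprime k n. [:- cis (2 * pi * real k / real n), 1:])"

text \<open>\<^const>\<open>quot_of_fract\<close> yields numerator and denominator in lowest terms.\<close>

definition ratfun_cong ::
  "complex poly fract \<Rightarrow> complex poly fract \<Rightarrow> complex poly \<Rightarrow> bool" where
  "ratfun_cong A C P \<longleftrightarrow>
     P dvd fst (quot_of_fract (A - C)) \<and> coprime (snd (quot_of_fract (A - C))) P"

definition Bsum :: "nat \<Rightarrow> 'a::field \<Rightarrow> 'a" where
  "Bsum n q = (of_nat n ^ 2 - 1) * (1 - q) ^ 2 / 24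
     + (\<Sum>k = 1..(n - 1) div 4. q ^ (4 * k - 2) / qint q (4 * k - 2) ^ 2)"

text \<open>
  In the congruence involving \<open>[8k+1]\<^bsub>q^2\<^esub> [8k+1]^2\<close> the power of \<open>q\<close> on the right-hand side
  has exponent \<open>(3 - n) / 2\<close>. The printed exponent \<open>(5 - n) / 2\<close> is a misprint: the two
  right-hand sides differ by \<open>1 - q\<close> times a factor that vanishes to order exactly one at the
  primitive \<open>n\<close>-th roots of unity, so at most one of them is correct modulo \<open>\<Phi>\<^sub>n(q)^2\<close>, and for
  \<open>n = 5\<close> specialisation to \<open>q = 2\<close> (where the modulus becomes \<open>31^4\<close>) rules out the printed
  one. That congruence also needs \<open>n > 1\<close>: for \<open>n = 1\<close> the modulus is \<open>(q - 1)^3\<close>, while at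
  \<open>q = 1\<close> the left-hand side is \<open>1\<close> and the right-hand side is \<open>-1\<close>.
\<close>

end

theory Submission
  imports Defs
begin

text \<open>
  Write \<open>n = 4m + 1\<close>, \<open>x = q^n\<close>, and \<open>\<phi>\<^sub>k(b) = (bq, q/b; q^4)\<^sub>k / (bq^4, q^4/b; q^4)\<^sub>k\<close>, so that the first
  sum is \<open>F(1,1)\<close> where \<open>F(b,c) = \<Sum>\<^sub>k [8k+1] q^(2k) \<phi>\<^sub>k(b) \<phi>\<^sub>k(c)\<close>. Since \<open>\<phi>\<^sub>k(1) - \<phi>\<^sub>k(x)\<close> is
  divisible by \<open>\<Phi>\<^sub>n\<^sup>2\<close>, completing the square gives \<open>F(1,1) \<equiv> 2 F(1,x) - F(x,x)\<close> modulo \<open>\<Phi>\<^sub>n^4\<close>. The sums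
  \<open>F(b,x)\<close> terminate, and a telescoping identity relates such a sum to one with shifted
  parameters. Iterating it evaluates \<open>F(1,x)\<close> in closed form; it also shows
  \<open>F(x,x) \<equiv> D F(1,x)\<close> with \<open>D = \<Prod>\<^sub>i (1 - q^(4i))\<^sup>2 / ((1 - xq^(4i)) (1 - q^(4i)/x))\<close>, because the
  inhomogeneous terms are divisible by \<open>(1-x)\<^sup>2\<close> and \<open>D \<equiv> 1\<close> modulo \<open>(1-x)\<^sup>2\<close>. The correction
  term in \<open>B(n,q)\<close> then comes from \<open>\<Sum> \<omega> / (1-\<omega>)\<^sup>2 = - (n\<^sup>2-1) / 12\<close> over the \<open>n\<close>-th roots of unity
  \<open>\<omega> \<noteq> 1\<close>. At the other \<open>n\<close>-th roots of unity, of order \<open>d\<close>, the sum splits into blocks of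
  length \<open>d\<close>, each of which vanishes because its terms are antisymmetric. Finally, a fixed
  linear combination of the second sum and of the first sum in base \<open>q\<^sup>2\<close> telescopes, so the second
  congruence follows from the first.
\<close>

section \<open>Very-well-poised sums\<close>

definition wp :: "'a::field \<Rightarrow> 'a \<Rightarrow> 'a \<Rightarrow> nat \<Rightarrow> 'a" where
  "wp a b Q k = qpoch b Q k / qpoch (a * Q / b) Q k"

text \<open>
  Up to the factor \<open>1 - aQ^(2k)\<close>, this is the summand of a very-well-poised \<open>\<^sub>8\<phi>\<^sub>7\<close> series with
  parameters \<open>b, c, d, e, Q\<close>; the parameter \<open>Q\<close> cancels the quotient \<open>(a;Q)\<^sub>k / (Q;Q)\<^sub>k\<close>.
\<close>

definition vwp :: "'a::field \<Rightarrow> 'a \<Rightarrow> 'a \<Rightarrow> 'a \<Rightarrow> 'a \<Rightarrow> 'a \<Rightarrow> nat \<Rightarrow> 'a" where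
  "vwp a b c d e Q k =
     wp a b Q k * wp a c Q k * wp a d Q k * wp a e Q k * (a ^ 2 * Q / (b * c * d * e)) ^ k"

section \<open>Shifted factorials and parameter shifts\<close>

lemma qpoch_0 [simp]: "qpoch a q 0 = 1"
  by (simp add: qpoch_def)

lemma qpoch_Suc: "qpoch a q (Suc k) = qpoch a q k * (1 - a * q ^ k)"
  by (simp add: qpoch_def)

lemma qpoch_shift: "(1 - a) * qpoch (a * q) q k = qpoch a q k * (1 - a * q ^ k)"
proof (induction k)
  case (Suc k)
  have "(1 - a) * qpoch (a * q) q (Suc k) = (1 - a) * qpoch (a * q) q k * (1 - a * q * q ^ k)"
    by (simp add: qpoch_Suc mult_ac)
  with Suc show ?case by (simp add: qpoch_Suc mult_ac)
qed simp

lemma qpoch_nonzero: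
  fixes a q :: "'a::idom"
  assumes "\<And>i. i < k \<Longrightarrow> a * q ^ i \<noteq> 1"
  shows "qpoch a q k \<noteq> 0"
  using assms by (auto simp: qpoch_def)

lemma qpoch_eq_0:
  assumes "a * q ^ i = 1" "i < k"
  shows "qpoch a q k = 0"
  using assms by (auto simp: qpoch_def intro!: prod_zero bexI[of _ i])

lemma wp_0 [simp]: "wp a b Q 0 = 1"
  by (simp add: wp_def)

lemma wp_Suc: "wp a b Q (Suc k) = wp a b Q k * ((1 - b * Q ^ k) / (1 - a * Q * Q ^ k / b))"
  by (simp add: wp_def qpoch_Suc)

text \<open>Only the denominator changes, from \<open>(aQ/b;Q)_k\<close> to
  \<open>(aQ^2/b;Q)_k\<close>; these products share all factors but one each. The hypothesis on
  \<open>a * Q ^ Suc i\<close> keeps both nonzero.\<close>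

lemma wp_shift_base:
  fixes a b Q :: "'a::field"
  assumes "b \<noteq> 0" "\<And>i. a * Q ^ Suc i \<noteq> b"
  shows "wp (a * Q) b Q k * (1 - a * Q * Q ^ k / b) = wp a b Q k * (1 - a * Q / b)"
proof -
  have 1: "(1 - a * Q / b) * qpoch (a * Q * Q / b) Q k
      = qpoch (a * Q / b) Q k * (1 - a * Q * Q ^ k / b)"
    using qpoch_shift[of "a * Q / b" Q k] by simp
  have "a * Q / b * Q ^ i \<noteq> 1" for i
    using assms(1) assms(2)[of i] by (simp add: field_simps)
  then have 2: "qpoch (a * Q / b) Q k \<noteq> 0" by (intro qpoch_nonzero)
  have "a * Q * Q / b * Q ^ i \<noteq> 1" for i
    using assms(1) assms(2)[of "Suc i"] by (simp add: field_simps)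
  then have 3: "qpoch (a * Q * Q / b) Q k \<noteq> 0" by (intro qpoch_nonzero)
  show ?thesis
    unfolding wp_def using 1 2 3 by (simp add: frac_eq_eq mult.assoc)
qed

text \<open>Multiplying \<open>a\<close> and \<open>d\<close> by \<open>Q\<close> together fixes
  \<open>aQ/d\<close>, so only the numerator changes.\<close>

lemma wp_shift_both:
  fixes a d Q :: "'a::field"
  assumes "Q \<noteq> 0"
  shows "wp (a * Q) (d * Q) Q k * (1 - d) = wp a d Q k * (1 - d * Q ^ k)"
proof -
  have "a * Q * Q / (d * Q) = a * Q / d" using assms by simp
  then show ?thesis
    unfolding wp_def using qpoch_shift[of d Q k] by (simp add: mult_ac)
qed

text \<open>This is \<open>vwp_telescope\<close> with the common factors taken out and
  \<open>y\<close> in place of \<open>Q^k\<close>. Clearing denominators leaves a polynomial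
  identity.\<close>

lemma telescoping_identity:
  fixes a b c d e Q y :: "'a::field"
  assumes "b \<noteq> 0" "c \<noteq> 0" "d \<noteq> 0" "e \<noteq> 0"
  shows "(1 - a * y ^ 2) * (1 - a * Q * y / b) * (1 - a * Q * y / c) * (a - d * e)
     - a * (1 - a * Q / (b * c)) * (1 - a * Q * y ^ 2) * (1 - d * y) * (1 - e * y)
   = d * e * (a ^ 2 * Q / (b * c * d * e) * (1 - b * y) * (1 - c * y) * (1 - d * y) * (1 - e * y)
       - (1 - a * y / d) * (1 - a * y / e) * (1 - a * Q * y / b) * (1 - a * Q * y / c))"
  using assms by (simp add: divide_simps) algebra

text \<open>A contiguous relation: up to a difference of \<open>G\<close>, the parameters
  \<open>a\<close>, \<open>d\<close>, \<open>e\<close> move to \<open>aQ\<close>, \<open>dQ\<close>,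
  \<open>eQ\<close> while \<open>b\<close> and \<open>c\<close> stay fixed. Factoring out the
  summand leaves rational functions of \<open>Q^k\<close>, related by
  \<open>telescoping_identity\<close>.\<close>

lemma vwp_telescope:
  fixes a b c d e Q :: "'a::field" and k :: nat
  defines "G \<equiv> \<lambda>k. vwp a b c d e Q k * ((1 - a * Q ^ k / d) * (1 - a * Q ^ k / e) / (1 - a / (d * e)))"
  defines "V \<equiv> (1 - a * Q / (b * c)) * (1 - d) * (1 - e)
                 / ((1 - d * e / a) * (1 - a * Q / b) * (1 - a * Q / c))"
  assumes nz: "a \<noteq> 0" "Q \<noteq> 0" "b \<noteq> 0" "c \<noteq> 0" "d \<noteq> 0" "e \<noteq> 0" and de: "d * e \<noteq> a"
    and b: "\<And>i. a * Q ^ Suc i \<noteq> b" and c: "\<And>i. a * Q ^ Suc i \<noteq> c"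
    and d: "\<And>i. a * Q ^ Suc i \<noteq> d" and e: "\<And>i. a * Q ^ Suc i \<noteq> e"
  shows "(1 - a * Q ^ (2 * k)) * vwp a b c d e Q k
     = V * ((1 - a * Q * Q ^ (2 * k)) * vwp (a * Q) b c (d * Q) (e * Q) Q k) + G k - G (Suc k)"
proof -
  define y where "y = Q ^ k"
  define X where "X = vwp a b c d e Q k"
  define Y where "Y = vwp (a * Q) b c (d * Q) (e * Q) Q k"
  define P where "P = (1 - a * Q * y / b) * (1 - a * Q * y / c)"
  define z where "z = a ^ 2 * Q / (b * c * d * e)"
  have ne: "1 - a * Q * y / f \<noteq> 0" if "f \<noteq> 0" "\<And>i. a * Q ^ Suc i \<noteq> f" for f
    using that(1) that(2)[of k] by (simp add: y_def field_simps)
  have ne1: "1 - a * Q / f \<noteq> 0" if "f \<noteq> 0" "\<And>i. a * Q ^ Suc i \<noteq> f" for f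
    using that(1) that(2)[of 0] by (simp add: field_simps)
  note ne' = ne[OF nz(3) b] ne[OF nz(4) c] ne[OF nz(5) d] ne[OF nz(6) e]
  note ne1' = ne1[OF nz(3) b] ne1[OF nz(4) c]
  have P: "P \<noteq> 0" using ne' by (simp add: P_def)
  have y2: "Q ^ (2 * k) = y ^ 2" by (simp add: y_def power_mult power2_eq_square mult_2 power_add)
  \<comment> \<open>The two factors in \<open>G\<close> involving \<open>d\<close> and
    \<open>e\<close> cancel exactly the denominators that \<open>wp_Suc\<close> adds for these
    parameters; those for \<open>b\<close> and \<open>c\<close> remain as \<open>P\<close>.\<close>
  have Suc: "vwp a b c d e Q (Suc k) * ((1 - a * Q * y / d) * (1 - a * Q * y / e))
      = X * z * (1 - b * y) * (1 - c * y) * (1 - d * y) * (1 - e * y) / P"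
  proof -
    have "A * (nb / db) * (B * (nc / dc)) * (C * (nd / dd)) * (D * (nf / df)) * (z * Z) * (dd * df)
        = A * B * C * D * Z * z * nb * nc * nd * nf / (db * dc)"
      if "dd \<noteq> 0" "df \<noteq> 0" for A B C D Z nb nc nd nf db dc dd df :: 'a
      using that by (simp add: mult_ac)
    from this[OF ne'(3,4)] show ?thesis
      unfolding X_def P_def vwp_def wp_Suc y_def[symmetric] z_def[symmetric] power_Suc .
  qed
  define Z where "Z = z * (1 - b * y) * (1 - c * y) * (1 - d * y) * (1 - e * y)"
  have Gs: "G (Suc k) = X * Z / P * (1 / (1 - a / (d * e)))"
  proof -
    have "G (Suc k) = vwp a b c d e Q (Suc k) * ((1 - a * Q * y / d) * (1 - a * Q * y / e)) * (1 / (1 - a / (d * e)))"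
      by (simp add: G_def y_def mult.assoc)
    also have "\<dots> = X * Z / P * (1 / (1 - a / (d * e)))"
      unfolding Suc Z_def by (simp only: mult.assoc)
    finally show ?thesis .
  qed
  have z': "(a * Q)\<^sup>2 * Q / (b * c * (d * Q) * (e * Q)) = z"
    using nz by (simp add: z_def field_simps power2_eq_square)
  have "Y * ((1 - d) * (1 - e)) * P
     = (wp (a * Q) b Q k * (1 - a * Q * Q ^ k / b)) * (wp (a * Q) c Q k * (1 - a * Q * Q ^ k / c))
       * (wp (a * Q) (d * Q) Q k * (1 - d)) * (wp (a * Q) (e * Q) Q k * (1 - e)) * z ^ k"
    unfolding Y_def vwp_def z' P_def y_def by (simp add: mult_ac)
  also have "\<dots> = X * ((1 - d * y) * (1 - e * y)) * ((1 - a * Q / b) * (1 - a * Q / c))"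
    unfolding wp_shift_base[OF nz(3) b] wp_shift_base[OF nz(4) c] wp_shift_both[OF nz(2)]
      X_def vwp_def z_def y_def by (simp add: mult_ac)
  finally have Y: "Y * ((1 - d) * (1 - e))
      = X * ((1 - d * y) * (1 - e * y)) * ((1 - a * Q / b) * (1 - a * Q / c)) / P"
    using P by (simp add: field_simps)
  have "V * ((1 - a * Q * y ^ 2) * Y)
      = (1 - a * Q / (b * c)) / ((1 - d * e / a) * ((1 - a * Q / b) * (1 - a * Q / c)))
         * (1 - a * Q * y ^ 2) * (Y * ((1 - d) * (1 - e)))"
    unfolding V_def by (simp add: mult_ac)
  also have "\<dots> = (1 - a * Q / (b * c)) / (1 - d * e / a) * (1 - a * Q * y ^ 2)
       * (X * ((1 - d * y) * (1 - e * y)) / P)"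
  proof -
    have "A / (B * (C * D)) * E * (F * (C * D) / P) = A / B * E * (F / P)"
      if "C \<noteq> 0" "D \<noteq> 0" for A B C D E F :: 'a
      using that by simp
    from this[OF ne1'] show ?thesis unfolding Y .
  qed
  also have "1 - d * e / a = (a - d * e) / a" using nz by (simp add: field_simps)
  finally have VY: "V * ((1 - a * Q * y ^ 2) * Y)
     = X / P / (a - d * e) * (a * (1 - a * Q / (b * c)) * (1 - a * Q * y ^ 2) * (1 - d * y) * (1 - e * y))"
    by (simp add: mult_ac)
  have k1: "1 / (1 - a / (d * e)) = - (d * e / (a - d * e))"
    using nz de by (simp add: field_simps)
  have GG: "G k - G (Suc k) = X / P / (a - d * e) * (d * e *
       (z * (1 - b * y) * (1 - c * y) * (1 - d * y) * (1 - e * y)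
         - (1 - a * y / d) * (1 - a * y / e) * (1 - a * Q * y / b) * (1 - a * Q * y / c)))"
  proof -
    define T where "T = (1 - a * y / d) * (1 - a * y / e)"
    have "G k = X * T * (1 / (1 - a / (d * e)))"
      by (simp add: G_def X_def T_def y_def)
    then have "G k - G (Suc k) = (X * T - X * Z / P) * (- (d * e / (a - d * e)))"
      unfolding Gs k1 by (simp only: left_diff_distrib)
    also have "\<dots> = X / P / (a - d * e) * (d * e * (Z - T * P))"
      using P de by (simp add: divide_simps) (simp add: algebra_simps)
    also have "T * P = (1 - a * y / d) * (1 - a * y / e) * (1 - a * Q * y / b) * (1 - a * Q * y / c)"
      by (simp only: T_def P_def mult.assoc)
    finally show ?thesis unfolding Z_def .
  qed
  have "V * ((1 - a * Q * y ^ 2) * Y) + G k - G (Suc k)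
      = V * ((1 - a * Q * y ^ 2) * Y) + (G k - G (Suc k))" by simp
  also have "\<dots> = X / P / (a - d * e) * ((1 - a * y ^ 2) * (1 - a * Q * y / b) * (1 - a * Q * y / c) * (a - d * e))"
    unfolding VY GG z_def telescoping_identity[OF nz(3-6), symmetric]
    by (simp add: right_diff_distrib)
  also have "\<dots> = (1 - a * y ^ 2) * X"
    using P de by (simp add: P_def mult_ac)
  finally show ?thesis by (simp add: y2 X_def Y_def)
qed

lemma vwp_sum_shift:
  fixes a b c d e Q :: "'a::field"
  assumes nz: "a \<noteq> 0" "Q \<noteq> 0" "b \<noteq> 0" "c \<noteq> 0" "d \<noteq> 0" "e \<noteq> 0" and de: "d * e \<noteq> a"
    and b: "\<And>i. a * Q ^ Suc i \<noteq> b" and c: "\<And>i. a * Q ^ Suc i \<noteq> c"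
    and d: "\<And>i. a * Q ^ Suc i \<noteq> d" and e: "\<And>i. a * Q ^ Suc i \<noteq> e"
    and N: "e * Q ^ N = 1" "N < K"
  shows "(\<Sum>k<K. (1 - a * Q ^ (2 * k)) * vwp a b c d e Q k)
     = (1 - a / d) * (1 - a / e) / (1 - a / (d * e))
      + (1 - a * Q / (b * c)) * (1 - d) * (1 - e)
                 / ((1 - d * e / a) * (1 - a * Q / b) * (1 - a * Q / c))
        * (\<Sum>k<K. (1 - a * Q * Q ^ (2 * k)) * vwp (a * Q) b c (d * Q) (e * Q) Q k)"
proof -
  \<comment> \<open>Since \<open>e = Q^(-N)\<close> with \<open>N < K\<close>, the product
    \<open>(e;Q)_K\<close> contains a zero factor. So the upper boundary term vanishes and only
    \<open>G 0\<close> survives.\<close>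
  have "vwp a b c d e Q K = 0"
    using qpoch_eq_0[OF N] by (simp add: vwp_def wp_def)
  then have GK: "vwp a b c d e Q K * ((1 - a * Q ^ K / d) * (1 - a * Q ^ K / e) / (1 - a / (d * e))) = 0"
    by simp
  have G0: "vwp a b c d e Q 0 * ((1 - a * Q ^ 0 / d) * (1 - a * Q ^ 0 / e) / (1 - a / (d * e)))
      = (1 - a / d) * (1 - a / e) / (1 - a / (d * e))"
    by (simp add: vwp_def)
  have tele: "(\<Sum>k<K. V * f k + G k - G (Suc k)) = G 0 + V * (\<Sum>k<K. f k) - G K"
    for V :: 'a and f G :: "nat \<Rightarrow> 'a"
    by (induction K) (simp_all add: algebra_simps)
  show ?thesis
    unfolding vwp_telescope[OF assms(1-11)]
    by (rule trans[OF tele[where G = "\<lambda>k. vwp a b c d e Q k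
      * ((1 - a * Q ^ k / d) * (1 - a * Q ^ k / e) / (1 - a / (d * e)))"]])
      (simp only: GK G0 diff_0_right)
qed

section \<open>Local orders of rational functions\<close>

text \<open>Regularity at \<open>z\<close> with value \<open>c\<close>. The fraction may be
  unreduced, so closure under arithmetic involves no gcd; only \<open>quot_of_fract_ord_ge\<close>
  returns to lowest terms.\<close>

definition has_val :: "complex \<Rightarrow> complex poly fract \<Rightarrow> complex \<Rightarrow> bool" where
  "has_val z x c \<longleftrightarrow>
     (\<exists>N D. poly D z \<noteq> 0 \<and> x = to_fract N / to_fract D \<and> c = poly N z / poly D z)"

text \<open>The cofactor must be regular at \<open>z\<close>, so even \<open>ord_ge z 0\<close>
  excludes a pole. This is what later yields denominators coprime to the modulus.\<close>

definition ord_ge :: "complex \<Rightarrow> nat \<Rightarrow> complex poly fract \<Rightarrow> bool" where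
  "ord_ge z k x \<longleftrightarrow> (\<exists>y c. x = to_fract [:- z, 1:] ^ k * y \<and> has_val z y c)"

section \<open>Arithmetic of values at a point\<close>

lemma to_fract_power: "to_fract (x ^ k) = to_fract x ^ k"
  by (induction k) simp_all

lemma has_val_to_fract: "has_val z (to_fract N) (poly N z)"
  unfolding has_val_def by (rule exI[of _ N], rule exI[of _ 1]) simp

lemma has_val_0: "has_val z 0 0"
  using has_val_to_fract[of z 0] by simp

lemma has_val_1: "has_val z 1 1"
  using has_val_to_fract[of z 1] by simp

lemma has_val_qvar: "has_val z qvar z"
  using has_val_to_fract[of z "[:0, 1:]"] by (simp add: qvar_def)

lemma has_val_add:
  assumes "has_val z x c" "has_val z y d"
  shows "has_val z (x + y) (c + d)"
proof -
  obtain N D N' D' where *: "poly D z \<noteq> 0" "x = to_fract N / to_fract D" "c = poly N z / poly D z"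
     "poly D' z \<noteq> 0" "y = to_fract N' / to_fract D'" "d = poly N' z / poly D' z"
    using assms unfolding has_val_def by blast
  then have "D \<noteq> 0" "D' \<noteq> 0" by auto
  with * have "x + y = to_fract (N * D' + N' * D) / to_fract (D * D')"
    "c + d = poly (N * D' + N' * D) z / poly (D * D') z" "poly (D * D') z \<noteq> 0"
    by (simp_all add: add_frac_eq)
  then show ?thesis unfolding has_val_def by blast
qed

lemma has_val_mult:
  assumes "has_val z x c" "has_val z y d"
  shows "has_val z (x * y) (c * d)"
proof -
  obtain N D N' D' where *: "poly D z \<noteq> 0" "x = to_fract N / to_fract D" "c = poly N z / poly D z"
     "poly D' z \<noteq> 0" "y = to_fract N' / to_fract D'" "d = poly N' z / poly D' z"
    using assms unfolding has_val_def by blast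
  then have "x * y = to_fract (N * N') / to_fract (D * D')"
    "c * d = poly (N * N') z / poly (D * D') z" "poly (D * D') z \<noteq> 0"
    by simp_all
  then show ?thesis unfolding has_val_def by blast
qed

lemma has_val_inverse:
  assumes "has_val z x c" "c \<noteq> 0"
  shows "has_val z (inverse x) (inverse c)"
proof -
  obtain N D where "poly D z \<noteq> 0" "x = to_fract N / to_fract D" "c = poly N z / poly D z"
    using assms unfolding has_val_def by blast
  with \<open>c \<noteq> 0\<close> show ?thesis
    unfolding has_val_def by (intro exI[of _ D] exI[of _ N]) auto
qed

lemma has_val_minus: "has_val z x c \<Longrightarrow> has_val z (- x) (- c)"
  using has_val_mult[OF has_val_to_fract[of z "- 1"]] by simp

lemma has_val_diff: "has_val z x c \<Longrightarrow> has_val z y d \<Longrightarrow> has_val z (x - y) (c - d)"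
  using has_val_add[OF _ has_val_minus] by fastforce

lemma has_val_divide:
  "has_val z x c \<Longrightarrow> has_val z y d \<Longrightarrow> d \<noteq> 0 \<Longrightarrow> has_val z (x / y) (c / d)"
  unfolding divide_inverse by (intro has_val_mult has_val_inverse)

lemma has_val_power: "has_val z x c \<Longrightarrow> has_val z (x ^ k) (c ^ k)"
  by (induction k) (auto intro: has_val_mult has_val_1)

lemma has_val_of_nat: "has_val z (of_nat k) (of_nat k)"
  by (induction k) (auto intro!: has_val_add has_val_1 has_val_0)

lemma has_val_numeral: "has_val z (numeral k) (numeral k)"
  using has_val_of_nat[of z "numeral k"] by simp

lemma has_val_sum:
  "(\<And>i. i \<in> A \<Longrightarrow> has_val z (f i) (g i)) \<Longrightarrow> has_val z (sum f A) (sum g A)"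
  by (induction A rule: infinite_finite_induct) (auto intro: has_val_add has_val_0)

lemma has_val_prod:
  "(\<And>i. i \<in> A \<Longrightarrow> has_val z (f i) (g i)) \<Longrightarrow> has_val z (prod f A) (prod g A)"
  by (induction A rule: infinite_finite_induct) (auto intro: has_val_mult has_val_1)

lemmas has_val_intros = has_val_0 has_val_1 has_val_add has_val_mult has_val_diff has_val_minus
  has_val_power has_val_of_nat has_val_numeral has_val_sum has_val_prod

lemma has_val_nonzero: "has_val z x c \<Longrightarrow> c \<noteq> 0 \<Longrightarrow> x \<noteq> 0"
  unfolding has_val_def by auto

lemma has_val_0_imp_ord_ge_1:
  assumes "has_val z x 0"
  shows "ord_ge z 1 x"
proof -
  obtain N D where *: "poly D z \<noteq> 0" "x = to_fract N / to_fract D" "poly N z = 0"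
    using assms unfolding has_val_def by auto
  then obtain N' where "N = [:- z, 1:] * N'" by (metis dvdE poly_eq_0_iff_dvd)
  with *(2) have "x = to_fract [:- z, 1:] ^ 1 * (to_fract N' / to_fract D)"
    by (simp only: to_fract_mult power_one_right times_divide_eq_right)
  moreover have "has_val z (to_fract N' / to_fract D) (poly N' z / poly D z)"
    by (intro has_val_divide has_val_to_fract * )
  ultimately show ?thesis unfolding ord_ge_def by blast
qed

section \<open>Arithmetic of orders at a point\<close>

lemma ord_ge_0_iff: "ord_ge z 0 x \<longleftrightarrow> (\<exists>c. has_val z x c)"
  by (simp add: ord_ge_def)

lemma has_val_imp_ord_ge_0: "has_val z x c \<Longrightarrow> ord_ge z 0 x"
  by (auto simp: ord_ge_0_iff)

lemma ord_ge_zero: "ord_ge z k 0"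
  unfolding ord_ge_def by (intro exI[of _ 0] conjI has_val_0) simp

lemma ord_ge_add: "ord_ge z k x \<Longrightarrow> ord_ge z k y \<Longrightarrow> ord_ge z k (x + y)"
proof -
  assume "ord_ge z k x" "ord_ge z k y"
  then obtain x' c y' d where "x = to_fract [:- z, 1:] ^ k * x'" "has_val z x' c"
    "y = to_fract [:- z, 1:] ^ k * y'" "has_val z y' d"
    unfolding ord_ge_def by blast
  then have "x + y = to_fract [:- z, 1:] ^ k * (x' + y')" "has_val z (x' + y') (c + d)"
    by (auto simp only: distrib_left intro: has_val_add)
  then show ?thesis unfolding ord_ge_def by blast
qed

lemma ord_ge_minus: "ord_ge z k x \<Longrightarrow> ord_ge z k (- x)"
proof -
  assume "ord_ge z k x"
  then obtain x' c where "x = to_fract [:- z, 1:] ^ k * x'" "has_val z x' c"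
    unfolding ord_ge_def by blast
  then have "- x = to_fract [:- z, 1:] ^ k * (- x')" "has_val z (- x') (- c)"
    by (auto intro: has_val_minus)
  then show ?thesis unfolding ord_ge_def by blast
qed

lemma ord_ge_diff: "ord_ge z k x \<Longrightarrow> ord_ge z k y \<Longrightarrow> ord_ge z k (x - y)"
  using ord_ge_add[OF _ ord_ge_minus] by fastforce

lemma ord_ge_sum: "(\<And>i. i \<in> A \<Longrightarrow> ord_ge z k (f i)) \<Longrightarrow> ord_ge z k (sum f A)"
  by (induction A rule: infinite_finite_induct) (auto intro: ord_ge_add ord_ge_zero)

lemma ord_ge_mult:
  assumes "ord_ge z k x" "ord_ge z l y"
  shows "ord_ge z (k + l) (x * y)"
proof -
  obtain x' c y' d where "x = to_fract [:- z, 1:] ^ k * x'" "has_val z x' c"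
    "y = to_fract [:- z, 1:] ^ l * y'" "has_val z y' d"
    using assms unfolding ord_ge_def by blast
  then have "x * y = to_fract [:- z, 1:] ^ (k + l) * (x' * y')" "has_val z (x' * y') (c * d)"
    by (auto simp only: power_add mult_ac intro: has_val_mult)
  then show ?thesis unfolding ord_ge_def by blast
qed

lemma ord_ge_mult_val: "ord_ge z k x \<Longrightarrow> has_val z y c \<Longrightarrow> ord_ge z k (x * y)"
  using ord_ge_mult[OF _ has_val_imp_ord_ge_0] by fastforce

lemma ord_ge_val_mult: "has_val z y c \<Longrightarrow> ord_ge z k x \<Longrightarrow> ord_ge z k (y * x)"
  using ord_ge_mult_val[of z k x y c] by (simp add: mult.commute)

lemma ord_ge_power: "ord_ge z k x \<Longrightarrow> ord_ge z (k * l) (x ^ l)"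
  by (induction l) (auto intro: ord_ge_mult has_val_imp_ord_ge_0 has_val_1)

lemma ord_ge_mono:
  assumes "ord_ge z k x" "l \<le> k"
  shows "ord_ge z l x"
proof -
  obtain x' c where "x = to_fract [:- z, 1:] ^ k * x'" "has_val z x' c"
    using assms unfolding ord_ge_def by blast
  then have "x = to_fract [:- z, 1:] ^ l * (to_fract [:- z, 1:] ^ (k - l) * x')"
    using assms(2) by (simp only: mult.assoc[symmetric] power_add[symmetric] le_add_diff_inverse)
  moreover have "has_val z (to_fract [:- z, 1:] ^ (k - l) * x') (poly [:- z, 1:] z ^ (k - l) * c)"
    by (intro has_val_mult has_val_power has_val_to_fract) fact
  ultimately show ?thesis unfolding ord_ge_def by blast
qed

text \<open>The bridge back to \<open>ratfun_cong\<close>. Cross-multiplying gives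
  \<open>n D = (X - z)^k N d\<close> with \<open>D(z)\<close> nonzero, so the power divides
  \<open>n\<close>. A zero of \<open>d\<close> at \<open>z\<close> would also be one of
  \<open>n\<close>, against coprimality.\<close>

lemma quot_of_fract_ord_ge:
  assumes "ord_ge z k x"
  shows "[:- z, 1:] ^ k dvd fst (quot_of_fract x)" "poly (snd (quot_of_fract x)) z \<noteq> 0"
proof -
  obtain N D where *: "poly D z \<noteq> 0" "x = to_fract [:- z, 1:] ^ k * (to_fract N / to_fract D)"
    using assms unfolding ord_ge_def has_val_def by blast
  then have x: "x = to_fract ([:- z, 1:] ^ k * N) / to_fract D"
    by (simp only: to_fract_power to_fract_mult times_divide_eq_right)
  define n where "n = fst (quot_of_fract x)"
  define d where "d = snd (quot_of_fract x)"
  have "d \<noteq> 0" by (simp add: d_def)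
  have "D \<noteq> 0" using * by auto
  have "x = to_fract n / to_fract d"
    unfolding n_def d_def Fract_conv_to_fract[symmetric] by simp
  with x have "to_fract (n * D) = to_fract ([:- z, 1:] ^ k * N * d)"
    using \<open>d \<noteq> 0\<close> \<open>D \<noteq> 0\<close> by (simp only: frac_eq_eq to_fract_mult to_fract_eq_0_iff mult_ac not_False_eq_True)
  then have eq: "n * D = [:- z, 1:] ^ k * N * d"
    by (simp only: to_fract_eq_iff)
  have "coprime n d" unfolding n_def d_def by (rule coprime_quot_of_fract)
  show "poly (snd (quot_of_fract x)) z \<noteq> 0"
  proof
    assume "poly (snd (quot_of_fract x)) z = 0"
    then have d: "poly d z = 0" by (simp add: d_def)
    then have "poly (n * D) z = 0" unfolding eq by simp
    then have "poly n z = 0" using * by simp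
    with d have "[:- z, 1:] dvd n" "[:- z, 1:] dvd d" by (simp_all add: poly_eq_0_iff_dvd)
    with \<open>coprime n d\<close> have "is_unit [:- z, 1:]" by (meson coprime_common_divisor)
    then show False by (simp add: is_unit_pCons_iff)
  qed
  have "coprime ([:- z, 1:] ^ k) D"
  proof -
    have "prime_elem [:- z, 1:]"
      by (intro prime_elem_linear_field_poly) simp
    then show ?thesis using *(1)
      by (intro coprime_power_left_iff[THEN iffD2] disjI1 prime_elem_imp_coprime) (auto simp: poly_eq_0_iff_dvd)
  qed
  moreover have "[:- z, 1:] ^ k dvd n * D" unfolding eq by (simp add: mult.assoc)
  ultimately show "[:- z, 1:] ^ k dvd fst (quot_of_fract x)"
    unfolding n_def by (simp add: coprime_dvd_mult_left_iff)
qed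

lemma coprime_linear_power:
  fixes p :: "complex poly"
  assumes "poly p z \<noteq> 0"
  shows "coprime p ([:- z, 1:] ^ k)"
proof -
  have "prime_elem [:- z, 1:]"
    by (intro prime_elem_linear_field_poly) simp
  then have "coprime [:- z, 1:] p"
    by (rule prime_elem_imp_coprime) (use assms in \<open>auto simp: poly_eq_0_iff_dvd\<close>)
  then show ?thesis by (simp add: coprime_commute)
qed

lemma prod_linear_powers_dvd:
  fixes p :: "complex poly"
  assumes "finite A" "inj_on f A" "\<And>k. k \<in> A \<Longrightarrow> [:- f k, 1:] ^ e k dvd p"
  shows "(\<Prod>k\<in>A. [:- f k, 1:] ^ e k) dvd p"
  using assms
proof (induction A rule: finite_induct)
  case (insert x A)
  have "coprime (\<Prod>k\<in>A. [:- f k, 1:] ^ e k) ([:- f x, 1:] ^ e x)"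
    by (rule coprime_linear_power) (use insert in \<open>auto simp: poly_prod\<close>)
  then have "(\<Prod>k\<in>A. [:- f k, 1:] ^ e k) * [:- f x, 1:] ^ e x dvd p"
    using insert by (intro divides_mult) auto
  then show ?case using insert by (simp add: mult.commute)
qed simp

section \<open>Factorisation of the modulus over the roots of unity\<close>

lemma inj_on_cis_root_unity:
  assumes "n > 0"
  shows "inj_on (\<lambda>k. cis (2 * pi * real k / real n)) {..<n}"
  using Complex.bij_betw_roots_unity[OF assms] by (simp add: bij_betw_def)

lemma cis_root_unity_power:
  assumes "n > 0"
  shows "cis (2 * pi * real k / real n) ^ n = 1"
proof -
  have "cis (2 * pi * real k / real n) ^ n = cis (2 * pi * real k)"
    using assms by (subst Complex.DeMoivre) simp
  also have "\<dots> = 1" by (rule cis_multiple_2pi) simp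
  finally show ?thesis .
qed

text \<open>The roots are distinct, so the product divides \<open>X^n - 1\<close>; both are monic of
  degree \<open>n\<close>, hence the cofactor is 1.\<close>

lemma prod_roots_unity:
  assumes "n > 0"
  shows "(\<Prod>k<n. [:- cis (2 * pi * real k / real n), 1:]) = [:0, 1:] ^ n - 1"
proof -
  let ?P = "\<Prod>k<n. [:- cis (2 * pi * real k / real n), 1:]"
  let ?R = "[:0, 1:] ^ n - 1 :: complex poly"
  have deg: "degree ?R = n" and lc: "lead_coeff ?R = 1"
  proof -
    have eq: "?R = monom 1 n + (- 1)" by (simp add: monom_altdef)
    show "degree ?R = n" unfolding eq using assms by (subst degree_add_eq_left) (simp_all add: degree_monom_eq)
    then show "lead_coeff ?R = 1" using assms by (simp add: eq)
  qed
  have "(\<Prod>k<n. [:- cis (2 * pi * real k / real n), 1:] ^ 1) dvd ?R"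
    using assms by (intro prod_linear_powers_dvd inj_on_cis_root_unity)
      (auto simp: poly_eq_0_iff_dvd[symmetric] cis_root_unity_power)
  then obtain c where c: "?R = ?P * c" by (auto elim: dvdE)
  have P: "degree ?P = n" by (simp add: degree_prod_eq_sum_degree)
  have lcP: "lead_coeff ?P = 1" unfolding lead_coeff_prod by simp
  have "c \<noteq> 0" using c lc by auto
  moreover have "?P \<noteq> 0" using lcP by auto
  ultimately have "degree c = 0" using arg_cong[OF c, of degree] deg P by (simp add: degree_mult_eq)
  moreover have "lead_coeff c = 1" using arg_cong[OF c, of lead_coeff] lc lcP by (simp only: lead_coeff_mult mult_1)
  ultimately have "c = 1" by (metis lead_coeff_pCons(2) degree_eq_zeroE one_pCons)
  with c show ?thesis by simp
qed

lemma qint_eq_prod: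
  assumes "n > 0"
  shows "qint [:0, 1:] n = (\<Prod>k\<in>{1..<n}. [:- cis (2 * pi * real k / real n), 1:])"
proof -
  define P where "P = (\<Prod>k\<in>{1..<n}. [:- cis (2 * pi * real k / real n), 1:])"
  \<comment> \<open>The index 0 carries the root 1, whose factor is cancelled by
    \<open>1 - q\<close>.\<close>
  have "{..<n} = insert 0 {1..<n}" using assms by auto
  then have "[:0, 1:] ^ n - 1 = [:- 1, 1:] * P"
    using prod_roots_unity[OF assms] by (simp add: P_def)
  then have "1 - [:0, 1:] ^ n = - ([:- 1, 1:] * P)"
    by (metis minus_diff_eq)
  also have "\<dots> = (1 - [:0, 1:]) * P"
    by (simp add: one_pCons)
  finally have "1 - [:0, 1:] ^ n = (1 - [:0, 1:]) * P" .
  moreover have "1 - [:0, 1:] \<noteq> (0 :: complex poly)" by (simp add: one_pCons)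
  ultimately show ?thesis
    unfolding qint_def P_def[symmetric] by simp
qed

text \<open>\<open>[n]\<close> vanishes simply at every \<open>n\<close>-th root of unity except 1,
  and the cube of the cyclotomic polynomial adds three zeros at each primitive one. So the
  congruence amounts to order 4 at primitive roots and order 1 at the others, checked point by
  point.\<close>

lemma ratfun_cong_local:
  assumes "n > 1"
    and ord: "\<And>k. 0 < k \<Longrightarrow> k < n \<Longrightarrow>
      ord_ge (cis (2 * pi * real k / real n)) (if coprime k n then 4 else 1) (A - C)"
  shows "ratfun_cong A C (qint [:0, 1:] n * cyclotomic n ^ 3)"
proof -
  define r where "r = (\<lambda>k::nat. [:- cis (2 * pi * real k / real n), 1:])"
  define e where "e = (\<lambda>k::nat. if coprime k n then 4 else 1 :: nat)"
  have "{k \<in> {1..n}. coprime k n} = {k \<in> {1..<n}. coprime k n}"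
    using assms(1) by (auto simp: order.order_iff_strict)
  then have "cyclotomic n = (\<Prod>k \<in> {k \<in> {1..<n}. coprime k n}. r k)"
    by (simp only: cyclotomic_def r_def)
  also have "\<dots> = (\<Prod>k\<in>{1..<n}. if coprime k n then r k else 1)"
    by (rule prod.inter_filter) simp
  finally have "qint [:0, 1:] n * cyclotomic n ^ 3
      = (\<Prod>k\<in>{1..<n}. r k * (if coprime k n then r k else 1) ^ 3)"
    using assms(1) unfolding qint_eq_prod[OF less_trans[OF zero_less_one assms(1)]] r_def
    by (simp only: prod.distrib prod_power_distrib)
  also have "\<dots> = (\<Prod>k\<in>{1..<n}. r k ^ e k)"
    by (intro prod.cong) (auto simp: e_def eval_nat_numeral)
  finally have eq: "qint [:0, 1:] n * cyclotomic n ^ 3 = (\<Prod>k\<in>{1..<n}. r k ^ e k)" .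
  show ?thesis
    unfolding ratfun_cong_def eq
  proof
    show "(\<Prod>k\<in>{1..<n}. r k ^ e k) dvd fst (quot_of_fract (A - C))"
      unfolding r_def using assms(1)
      by (intro prod_linear_powers_dvd inj_on_subset[OF inj_on_cis_root_unity])
        (auto simp only: e_def atLeastLessThan_iff intro!: quot_of_fract_ord_ge(1)[OF ord])
    show "coprime (snd (quot_of_fract (A - C))) (\<Prod>k\<in>{1..<n}. r k ^ e k)"
      unfolding r_def
      by (intro prod_coprime_right coprime_linear_power quot_of_fract_ord_ge(2)[OF ord]) auto
  qed
qed

section \<open>The sum at a root of unity\<close>

text \<open>\<open>qratio 1\<close> is the ratio raised to the fourth power in the first sum, and
  \<open>qratio 2\<close> the one in its closed form; the second congruence uses both in base
  \<open>q^2\<close>.\<close>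

definition qratio :: "nat \<Rightarrow> 'a::field \<Rightarrow> nat \<Rightarrow> 'a" where
  "qratio s q k = qpoch (q ^ s) (q ^ 4) k / qpoch (q ^ 4) (q ^ 4) k"

lemma qratio_0 [simp]: "qratio s q 0 = 1"
  by (simp add: qratio_def)

lemma qratio_Suc:
  "qratio s q (Suc k) = qratio s q k * ((1 - q ^ (4 * k + s)) / (1 - q ^ (4 * k + 4)))"
  by (simp add: qratio_def qpoch_Suc power_add mult.commute flip: power_mult)

lemma qratio_eq_prod: "qratio s q k = (\<Prod>i<k. (1 - q ^ (4 * i + s)) / (1 - q ^ (4 * i + 4)))"
  by (induction k) (simp_all add: qratio_Suc)

text \<open>The power \<open>e\<close> is \<open>1\<close> for the first congruence and \<open>2\<close> for the second, whose base is \<open>q\<^sup>2\<close>.\<close>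

locale root_of_unity_point =
  fixes z w :: complex and p :: "complex poly fract" and e d m :: nat
  assumes z_nonzero: "z \<noteq> 0" and e_pos: "e > 0" and p_eq: "p = qvar ^ e" and w_eq: "w = z ^ e"
    and order: "w ^ i = 1 \<longleftrightarrow> d dvd i" and d_gt_1: "d > 1" and d_dvd: "d dvd 4 * m + 1"
begin

section \<open>Values and zeros of \<open>1 - p^i\<close> at \<open>z\<close>\<close>

lemma val_p: "has_val z p w"
  unfolding p_eq w_eq by (intro has_val_power has_val_qvar)

lemma w_nonzero: "w \<noteq> 0"
  using z_nonzero by (simp add: w_eq)

lemma w_neq_1: "w \<noteq> 1"
  using order[of 1] d_gt_1 by simp

lemma p_nonzero: "p \<noteq> 0"
  using has_val_nonzero[OF val_p w_nonzero] .

lemma p_power_eq_iff: "p ^ i = p ^ j \<longleftrightarrow> i = j"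
proof
  assume eq: "p ^ i = p ^ j"
  \<comment> \<open>Evaluation at the point 2, unrelated to \<open>z\<close>, separates the powers
    of \<open>p\<close>: the values \<open>2^(ek)\<close> have distinct absolute values.\<close>
  have "has_val 2 (p ^ k) (2 ^ (e * k))" for k
    unfolding p_eq power_mult by (intro has_val_power has_val_qvar)
  then have "has_val 2 (p ^ i - p ^ j) (2 ^ (e * i) - 2 ^ (e * j))"
    by (intro has_val_diff)
  then have "(2 :: complex) ^ (e * i) = 2 ^ (e * j)"
    using eq has_val_nonzero[of 2 "p ^ i - p ^ j" "2 ^ (e * i) - 2 ^ (e * j)"] by auto
  then have "norm ((2 :: complex) ^ (e * i)) = norm ((2 :: complex) ^ (e * j))" by simp
  then have "(2 :: real) ^ (e * i) = 2 ^ (e * j)"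
    by (simp only: norm_power norm_numeral)
  then show "i = j" using e_pos by simp
qed simp

lemma p_power_eq_1_iff: "p ^ i = 1 \<longleftrightarrow> i = 0"
  using p_power_eq_iff[of i 0] by simp

lemma val_p_power: "has_val z (p ^ i) (w ^ i)"
  by (intro has_val_power val_p)

lemma val_one_minus: "has_val z (1 - p ^ i) (1 - w ^ i)"
  by (intro has_val_diff has_val_1 val_p_power)

lemma ord_one_minus: "d dvd i \<Longrightarrow> ord_ge z 1 (1 - p ^ i)"
  using val_one_minus[of i] order[of i] by (intro has_val_0_imp_ord_ge_1) simp

text \<open>The value of the cofactor is the derivative of \<open>1 - q^(el)\<close> at
  \<open>z\<close>, using \<open>z^(el) = 1\<close>. Dividing two such factorisations takes the
  place of l'Hospital's rule in \<open>val_one_minus_ratio\<close>.\<close>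

lemma simple_zero_one_minus:
  assumes "d dvd l"
  shows "\<exists>y. 1 - p ^ l = to_fract [:- z, 1:] * y \<and> has_val z y (- of_nat l * (of_nat e / z))"
proof (cases "l = 0")
  case True
  then show ?thesis by (intro exI[of _ 0]) (auto intro: has_val_0)
next
  case False
  define L where "L = e * l"
  have L: "L > 0" using False e_pos by (simp add: L_def)
  have zL: "z ^ L = 1" using order[of l] assms by (simp add: L_def power_mult w_eq)
  let ?c = "to_fract [:z:]"
  have c: "has_val z ?c z" using has_val_to_fract[of z "[:z:]"] by simp
  define y where "y = - (\<Sum>i<L. ?c ^ (L - Suc i) * qvar ^ i)"
  have "?c ^ L = to_fract ([:z:] ^ L)" by (simp add: to_fract_power)
  also have "[:z:] ^ L = 1" using zL by (simp add: poly_const_pow one_pCons)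
  finally have cL: "?c ^ L = 1" by simp
  have "1 - p ^ l = - (qvar ^ L - ?c ^ L)"
    unfolding cL by (simp add: p_eq L_def power_mult)
  also have "\<dots> = (qvar - ?c) * y"
    unfolding power_diff_sumr2 y_def by simp
  also have "qvar - ?c = to_fract [:- z, 1:]"
    unfolding qvar_def by (simp flip: to_fract_diff)
  finally have "1 - p ^ l = to_fract [:- z, 1:] * y" .
  moreover have "has_val z y (- (\<Sum>i<L. z ^ (L - Suc i) * z ^ i))"
    unfolding y_def by (intro has_val_intros c has_val_qvar)
  moreover have "(\<Sum>i<L. z ^ (L - Suc i) * z ^ i) = (\<Sum>i<L. 1 / z)"
  proof (intro sum.cong refl)
    fix i assume "i \<in> {..<L}"
    then have "z ^ (L - Suc i) * z ^ i * z = z ^ L"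
      by (simp flip: power_add power_Suc2)
    then show "z ^ (L - Suc i) * z ^ i = 1 / z"
      using zL z_nonzero by (simp add: field_simps)
  qed
  ultimately show ?thesis by (auto simp: L_def mult_ac)
qed

lemma val_one_minus_ratio:
  assumes "d dvd A" "d dvd B" "B > 0"
  shows "has_val z ((1 - p ^ A) / (1 - p ^ B)) (of_nat A / of_nat B)"
proof -
  obtain y where y: "1 - p ^ A = to_fract [:- z, 1:] * y" "has_val z y (- of_nat A * (of_nat e / z))"
    using simple_zero_one_minus[OF assms(1)] by blast
  obtain x where x: "1 - p ^ B = to_fract [:- z, 1:] * x" "has_val z x (- of_nat B * (of_nat e / z))"
    using simple_zero_one_minus[OF assms(2)] by blast
  have "has_val z (y / x) (- of_nat A * (of_nat e / z) / (- of_nat B * (of_nat e / z)))"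
    using y x assms(3) e_pos z_nonzero by (intro has_val_divide) auto
  then show ?thesis
    unfolding x y using e_pos z_nonzero by simp
qed

text \<open>As \<open>4m\<close> is congruent to -1 modulo \<open>d\<close>, the number 4 is
  invertible modulo \<open>d\<close>.\<close>

lemma dvd_4_mult_imp_dvd:
  assumes "d dvd 4 * i"
  shows "d dvd i"
proof -
  have "d dvd 4 * i * m + i" using d_dvd dvd_mult[of d "4 * m + 1" i] by (simp add: algebra_simps)
  then show ?thesis using assms by (simp add: dvd_add_right_iff)
qed

text \<open>At \<open>z\<close> the factors are periodic in the index with period \<open>d\<close>,
  and none of the denominators vanishes as long as \<open>i + 1 < d\<close>.\<close>

lemma val_qratio_shift:
  assumes "r < d"
  shows "has_val z (\<Prod>i<r. (1 - p ^ (4 * (j * d + i) + s)) / (1 - p ^ (4 * (j * d + i) + 4)))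
           (qratio s w r)"
  unfolding qratio_eq_prod
proof (intro has_val_prod)
  fix i assume "i \<in> {..<r}"
  with assms have i: "i + 1 < d" by simp
  have "w ^ (j * d * 4) = 1" by (simp add: order)
  then have eq: "w ^ (4 * (j * d + i) + t) = w ^ (4 * i + t)" for t
    by (simp add: algebra_simps power_add)
  have "w ^ (4 * (i + 1)) \<noteq> 1"
    unfolding order using dvd_4_mult_imp_dvd[of "i + 1"] i nat_dvd_not_less[of "i + 1" d] by auto
  then have "w ^ (4 * i + 4) \<noteq> 1" by (simp add: algebra_simps)
  then show "has_val z ((1 - p ^ (4 * (j * d + i) + s)) / (1 - p ^ (4 * (j * d + i) + 4)))
     ((1 - w ^ (4 * i + s)) / (1 - w ^ (4 * i + 4)))"
    using has_val_divide[OF val_one_minus[of "4 * (j * d + i) + s"] val_one_minus[of "4 * (j * d + i) + 4"]]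
    unfolding eq by simp
qed

text \<open>In a block of \<open>d\<close> consecutive indices exactly one denominator factor
  vanishes at \<open>z\<close>, the one at \<open>i = d - 1\<close>. A numerator factor vanishes
  too, at \<open>i0\<close>, and \<open>val_one_minus_ratio\<close> makes the quotient of these two
  regular.\<close>

lemma val_full_block:
  "\<exists>c. has_val z (\<Prod>i<d. (1 - p ^ (4 * (j * d + i) + s)) / (1 - p ^ (4 * (j * d + i) + 4))) c"
proof -
  \<comment> \<open>Because \<open>4m\<close> is -1 modulo \<open>d\<close>, the index
    \<open>s * m\<close> solves \<open>4i + s = 0\<close> modulo \<open>d\<close>.\<close>
  define i0 where "i0 = s * m mod d"
  have i0: "i0 < d" using d_gt_1 by (simp add: i0_def)
  have "d dvd s * (4 * m + 1)" using d_dvd by (rule dvd_mult)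
  also have "s * (4 * m + 1) = 4 * (s * m) + s" by (simp add: algebra_simps)
  finally have "d dvd 4 * (s * m) + s" .
  moreover have "[4 * i0 + s = 4 * (s * m) + s] (mod d)"
    unfolding i0_def by (intro cong_add cong_mult cong_refl) (simp add: cong_def)
  ultimately have "d dvd 4 * i0 + s" by (simp add: cong_dvd_iff)
  then have "d dvd (4 * j) * d + (4 * i0 + s)" by (rule dvd_add[OF dvd_triv_right])
  also have "(4 * j) * d + (4 * i0 + s) = 4 * (j * d + i0) + s" by (simp add: algebra_simps)
  finally have i0': "d dvd 4 * (j * d + i0) + s" .
  let ?f = "\<lambda>i. 1 - p ^ (4 * (j * d + i) + s)" and ?g = "\<lambda>i. 1 - p ^ (4 * (j * d + i) + 4)"
  have d': "4 * (j * d + (d - 1)) + 4 = 4 * (j * d + d)" using d_gt_1 by simp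
  have "prod ?f {..<d} = ?f i0 * prod ?f ({..<d} - {i0})"
    using i0 by (intro prod.remove) auto
  moreover have "prod ?g {..<d} = ?g (d - 1) * prod ?g ({..<d} - {d - 1})"
    using d_gt_1 by (intro prod.remove) auto
  ultimately have eq: "(\<Prod>i<d. ?f i / ?g i)
      = (?f i0 / ?g (d - 1)) * (prod ?f ({..<d} - {i0}) / prod ?g ({..<d} - {d - 1}))"
    by (simp only: prod_dividef times_divide_times_eq)
  have v1: "has_val z (?f i0 / ?g (d - 1))
      (of_nat (4 * (j * d + i0) + s) / of_nat (4 * (j * d + (d - 1)) + 4))"
    using i0'
  proof (rule val_one_minus_ratio)
    show "d dvd 4 * (j * d + (d - 1)) + 4" unfolding d' by simp
  qed simp
  have v2: "has_val z (prod ?f ({..<d} - {i0}) / prod ?g ({..<d} - {d - 1}))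
     ((\<Prod>i\<in>{..<d} - {i0}. 1 - w ^ (4 * (j * d + i) + s))
       / (\<Prod>i\<in>{..<d} - {d - 1}. 1 - w ^ (4 * (j * d + i) + 4)))"
  proof (intro has_val_divide has_val_prod val_one_minus)
    have "w ^ (4 * (j * d + i) + 4) \<noteq> 1" if "i < d" "i \<noteq> d - 1" for i
    proof -
      have "\<not> d dvd i + 1" using that by (intro nat_dvd_not_less) auto
      then have "\<not> d dvd j * d + (i + 1)" by (simp add: dvd_add_right_iff del: One_nat_def)
      then have "\<not> d dvd 4 * (j * d + (i + 1))" using dvd_4_mult_imp_dvd by blast
      then show ?thesis unfolding order by (simp add: algebra_simps)
    qed
    then show "(\<Prod>i\<in>{..<d} - {d - 1}. 1 - w ^ (4 * (j * d + i) + 4)) \<noteq> 0" by auto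
  qed
  show ?thesis unfolding eq by (rule exI, rule has_val_mult[OF v1 v2])
qed

text \<open>A factorisation of q-Lucas type: the block number and the position inside the block
  contribute separate factors. \<open>C j\<close> is the value at the start of block
  \<open>j\<close>.\<close>

lemma val_qratio_blocks:
  "\<exists>C. \<forall>j r. r < d \<longrightarrow> has_val z (qratio s p (j * d + r)) (C j * qratio s w r)"
proof -
  have split: "(\<Prod>i<j * d + r. f i) = (\<Prod>i<j * d. f i) * (\<Prod>i<r. f (j * d + i))"
    for f :: "nat \<Rightarrow> complex poly fract" and j r
    by (induction r) (simp_all add: mult_ac)
  have "\<exists>c. has_val z (qratio s p (j * d)) c" for j
  proof (induction j)
    case 0
    then show ?case using has_val_1 by auto
  next
    case (Suc j)
    then obtain c where "has_val z (qratio s p (j * d)) c" by blast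
    moreover obtain c' where
      "has_val z (\<Prod>i<d. (1 - p ^ (4 * (j * d + i) + s)) / (1 - p ^ (4 * (j * d + i) + 4))) c'"
      using val_full_block by blast
    ultimately have "has_val z (qratio s p (j * d + d)) (c * c')"
      unfolding qratio_eq_prod split by (rule has_val_mult)
    then show ?case by (auto simp: add.commute)
  qed
  then obtain C where C: "\<And>j. has_val z (qratio s p (j * d)) (C j)" by metis
  have "has_val z (qratio s p (j * d + r)) (C j * qratio s w r)" if "r < d" for j r
    unfolding qratio_eq_prod[of s p] split
    by (intro has_val_mult val_qratio_shift that C[unfolded qratio_eq_prod])
  then show ?thesis by blast
qed

lemma val_qratio: "\<exists>c. has_val z (qratio s p k) c"
proof -
  obtain C where "\<And>j r. r < d \<Longrightarrow> has_val z (qratio s p (j * d + r)) (C j * qratio s w r)"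
    using val_qratio_blocks by metis
  from this[of "k mod d" "k div d"] show ?thesis using d_gt_1 by auto
qed

end

section \<open>A telescoping sum linking the two congruences\<close>

lemma qratio_Suc_mult:
  fixes q :: "'a::field"
  assumes "q ^ (4 * k + 4) \<noteq> 1"
  shows "qratio s q (Suc k) * (1 - q ^ (4 * k + 4)) = qratio s q k * (1 - q ^ (4 * k + s))"
  using assms by (simp add: qratio_Suc)

lemma sum_lessThan_add:
  fixes f :: "nat \<Rightarrow> 'a::comm_monoid_add"
  shows "(\<Sum>k<a + b. f k) = (\<Sum>k<a. f k) + (\<Sum>k<b. f (a + k))"
  by (induction b) (simp_all add: add.assoc)

text \<open>The last bracket is the combination for which the sum telescopes; the boundary term is
  zero at \<open>K = 0\<close> through \<open>1 - q^(4K)\<close>. It ties the sum weighted by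
  \<open>q^(-2k) + q^(6k+1)\<close>, which arises from the second congruence, to the one weighted by
  \<open>q^(2k)\<close>.\<close>

lemma well_poised_telescoping:
  fixes q :: "'a::field"
  assumes "q \<noteq> 0" "\<And>k. q ^ (4 * k + 4) \<noteq> 1"
  shows "(1 - q) * (\<Sum>k<K. (1 - q ^ (8 * k + 1)) * qratio 1 q k ^ 4
           * ((1 + q) * (inverse q ^ (2 * k) + q ^ (6 * k + 1)) - 4 * q * q ^ (2 * k)))
     = q ^ 2 * ((qratio 1 q K * (1 - q ^ (4 * K))) ^ 4 * inverse q ^ (2 * K))"
proof (induction K)
  case (Suc K)
  define s where "s = q ^ (2 * K)"
  define t where "t = qratio 1 q K"
  have s: "s \<noteq> 0" "inverse q ^ (2 * K) = 1 / s"
    using assms by (simp_all add: s_def power_inverse divide_inverse)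
  have pw: "q ^ (4 * K) = s ^ 2" "q ^ (6 * K + 1) = q * s ^ 3" "q ^ (8 * K + 1) = q * s ^ 4"
    "q ^ (4 * K + 1) = q * s ^ 2"
    by (simp_all add: s_def mult.commute flip: power_mult power_add)
  have i: "inverse q ^ (2 * Suc K) = 1 / (q ^ 2 * s)"
    using assms by (simp add: s_def power_inverse divide_inverse power_add[symmetric])
  have "qratio 1 q (Suc K) * (1 - q ^ (4 * Suc K)) = t * (1 - q * s ^ 2)"
    using qratio_Suc_mult[OF assms(2), of 1 K] by (simp add: pw t_def add.commute)
  then have "q ^ 2 * ((qratio 1 q (Suc K) * (1 - q ^ (4 * Suc K))) ^ 4 * inverse q ^ (2 * Suc K))
     = (t * (1 - q * s ^ 2)) ^ 4 / s"
    unfolding i using assms(1) by simp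
  also have "\<dots> = q ^ 2 * ((t * (1 - s ^ 2)) ^ 4 * (1 / s))
       + (1 - q) * ((1 - q * s ^ 4) * t ^ 4 * ((1 + q) * (1 / s + q * s ^ 3) - 4 * q * s))"
  proof -
    \<comment> \<open>With \<open>s = q^(2K)\<close> the induction step is a polynomial identity
      once \<open>1/s\<close> is taken out.\<close>
    have "(t * (1 - q * s ^ 2)) ^ 4 = q ^ 2 * (t * (1 - s ^ 2)) ^ 4
       + (1 - q) * ((1 - q * s ^ 4) * t ^ 4 * ((1 + q) * (1 + q * s ^ 4) - 4 * q * s ^ 2))"
      by algebra
    moreover have "(1 + q) * (1 / s + q * s ^ 3) - 4 * q * s
        = ((1 + q) * (1 + q * s ^ 4) - 4 * q * s ^ 2) / s"
      using s(1) by (simp add: field_simps eval_nat_numeral)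
    ultimately show ?thesis by (simp add: add_divide_distrib)
  qed
  also have "q ^ 2 * ((t * (1 - s ^ 2)) ^ 4 * (1 / s)) =
     (1 - q) * (\<Sum>k<K. (1 - q ^ (8 * k + 1)) * qratio 1 q k ^ 4
           * ((1 + q) * (inverse q ^ (2 * k) + q ^ (6 * k + 1)) - 4 * q * q ^ (2 * k)))"
    unfolding Suc s pw t_def ..
  also have "(1 - q * s ^ 4) * t ^ 4 * ((1 + q) * (1 / s + q * s ^ 3) - 4 * q * s)
     = (1 - q ^ (8 * K + 1)) * qratio 1 q K ^ 4
           * ((1 + q) * (inverse q ^ (2 * K) + q ^ (6 * K + 1)) - 4 * q * q ^ (2 * K))"
    unfolding s pw t_def s_def[symmetric] ..
  finally show ?case by (simp add: distrib_left)
qed simp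

section \<open>Reflection symmetry of the sum at a root of unity\<close>

context root_of_unity_point
begin

text \<open>The index \<open>m mod d\<close> is that of a vanishing numerator factor of
  \<open>qratio 1 w\<close>. The ratio is therefore zero beyond it, and \<open>r\<close> is
  reflected to \<open>m mod d - r\<close>.\<close>

lemma w_reflection_point: "w ^ (4 * (m mod d) + 1) = 1"
proof -
  have "[4 * (m mod d) + 1 = 4 * m + 1] (mod d)"
    by (intro cong_add cong_mult cong_refl) (simp add: cong_def)
  then show ?thesis unfolding order using d_dvd by (simp only: cong_dvd_iff)
qed

lemma qratio_w_eq_0: "m mod d < r \<Longrightarrow> qratio 1 w r = 0"
  unfolding qratio_eq_prod using w_reflection_point by (intro prod_zero bexI[of _ "m mod d"]) auto

text \<open>Put \<open>r0 = m mod d\<close>. Because \<open>w^(4 r0 + 1) = 1\<close>, the factors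
  counted back from \<open>r0\<close> are those counted from 0 with \<open>w\<close> inverted and
  numerator and denominator exchanged. Undoing the inversion costs \<open>w^3\<close> per
  step.\<close>

lemma qratio_w_reflect:
  "r \<le> m mod d \<Longrightarrow> qratio 1 w (m mod d - r) = w ^ (3 * r) * qratio 1 w r * qratio 1 w (m mod d)"
proof (induction r)
  case (Suc r)
  define r0 where "r0 = m mod d"
  have r: "r < r0" "r0 < d" using Suc.prems d_gt_1 by (simp_all add: r0_def)
  define P where "P = w ^ (4 * r + 4)"
  define R where "R = w ^ (4 * r + 1)"
  define i where "i = r0 - Suc r"
  have i: "r0 - r = Suc i" using r by (simp add: i_def)
  have PR: "P = R * w ^ 3" by (simp add: P_def R_def power_add mult_ac eval_nat_numeral)
  have "w ^ (4 * i + 1) * P = w ^ (4 * r0 + 1)"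
    unfolding P_def power_add[symmetric] using r by (intro arg_cong[of _ _ "\<lambda>k. w ^ k"]) (simp add: i_def)
  then have aP: "w ^ (4 * i + 1) = 1 / P"
    using w_reflection_point w_nonzero by (simp add: r0_def P_def field_simps)
  have "w ^ (4 * i + 4) * R = w ^ (4 * r0 + 1)"
    unfolding R_def power_add[symmetric] using r by (intro arg_cong[of _ _ "\<lambda>k. w ^ k"]) (simp add: i_def)
  then have bR: "w ^ (4 * i + 4) = 1 / R"
    using w_reflection_point w_nonzero by (simp add: r0_def R_def field_simps)
  have "P = w ^ (4 * (r + 1))" by (simp add: P_def algebra_simps)
  then have P1: "P \<noteq> 1"
    using dvd_4_mult_imp_dvd[of "r + 1"] nat_dvd_not_less[of "r + 1" d] r order by auto
  have R1: "R \<noteq> 1"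
  proof
    assume "R = 1"
    then have "d dvd 4 * r + 1" by (simp only: R_def order)
    moreover have "d dvd 4 * r0 + 1" using w_reflection_point unfolding r0_def order .
    ultimately have "d dvd (4 * r0 + 1) - (4 * r + 1)" by (rule dvd_diff_nat[rotated])
    also have "(4 * r0 + 1) - (4 * r + 1) = 4 * (r0 - r)" by simp
    finally have "d dvd r0 - r" by (rule dvd_4_mult_imp_dvd)
    then show False using r nat_dvd_not_less[of "r0 - r" d] by auto
  qed
  have nz: "R \<noteq> 0" "w \<noteq> 0" using w_nonzero by (simp_all add: R_def)
  have "qratio 1 w (r0 - r) = qratio 1 w i * ((1 - 1 / P) / (1 - 1 / R))"
    unfolding i qratio_Suc aP bR ..
  also have "(1 - 1 / P) / (1 - 1 / R) = (1 - P) / ((1 - R) * w ^ 3)"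
    using nz P1 R1 by (simp add: PR divide_simps) algebra
  finally have "qratio 1 w i = qratio 1 w (r0 - r) * w ^ 3 * ((1 - R) / (1 - P))"
    using P1 R1 nz by simp
  also have "\<dots> = w ^ (3 * r) * w ^ 3 * (qratio 1 w r * ((1 - R) / (1 - P))) * qratio 1 w r0"
    using Suc by (simp add: r0_def mult_ac)
  also have "qratio 1 w r * ((1 - R) / (1 - P)) = qratio 1 w (Suc r)"
    by (simp add: qratio_Suc P_def R_def)
  finally show ?case by (simp add: i_def r0_def power_add mult_ac)
qed simp

definition root_term :: "nat \<Rightarrow> complex" where
  "root_term r = (1 - w ^ (8 * r + 1)) * qratio 1 w r ^ 4 * w ^ (2 * r)"

lemma root_term_reflect:
  assumes "r \<le> m mod d"
  shows "root_term (m mod d - r) = - root_term r"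
proof -
  define r0 where "r0 = m mod d"
  define a where "a = w ^ r"
  define b where "b = w ^ r0"
  define T where "T = qratio 1 w r"
  define T0 where "T0 = qratio 1 w r0"
  have nz: "a \<noteq> 0" "b \<noteq> 0" using w_nonzero by (simp_all add: a_def b_def)
  have ba: "w ^ (r0 - r) = b / a"
    using assms w_nonzero by (simp add: a_def b_def r0_def power_diff)
  have b4: "b ^ 4 * w = 1"
    using w_reflection_point by (simp add: b_def r0_def mult.commute flip: power_mult)
  \<comment> \<open>This is the reflection at \<open>r = m mod d\<close> itself, where the left-hand
    side is \<open>qratio 1 w 0 = 1\<close>.\<close>
  have "T0 ^ 2 * b ^ 3 = 1"
    using qratio_w_reflect[of "m mod d"]
    by (simp add: T0_def b_def r0_def power2_eq_square mult_ac flip: power_mult)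
  then have T0: "T0 ^ 4 * b ^ 6 = 1" by algebra
  have pw: "w ^ (8 * k + 1) = (w ^ k) ^ 8 * w" "w ^ (2 * k) = (w ^ k) ^ 2" "w ^ (3 * k) = (w ^ k) ^ 3" for k
    by (simp_all add: mult.commute flip: power_mult)
  have "root_term (m mod d - r) = (1 - (b / a) ^ 8 * w) * (a ^ 3 * T * T0) ^ 4 * (b / a) ^ 2"
    unfolding root_term_def qratio_w_reflect[OF assms] pw
    by (simp only: T_def T0_def ba[unfolded r0_def] r0_def a_def)
  also have "\<dots> = (a ^ 8 - b ^ 8 * w) * a ^ 2 * T ^ 4 * (T0 ^ 4 * b ^ 2)"
    using nz by (simp add: field_simps eval_nat_numeral)
  also have "T0 ^ 4 * b ^ 2 = w" using b4 T0 by algebra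
  also have "(a ^ 8 - b ^ 8 * w) * a ^ 2 * T ^ 4 * w = - ((1 - a ^ 8 * w) * T ^ 4 * a ^ 2)"
    using b4 by algebra
  finally show ?thesis by (simp only: root_term_def[of r] pw a_def T_def)
qed

text \<open>Antisymmetry gives \<open>S = -S\<close> for the sum up to \<open>m mod d\<close>, and
  all later terms are zero.\<close>

lemma sum_root_term:
  assumes "m mod d < R"
  shows "(\<Sum>r<R. root_term r) = 0"
proof -
  let ?S = "\<Sum>r<Suc (m mod d). root_term r"
  have "?S = (\<Sum>r<Suc (m mod d). root_term (Suc (m mod d) - Suc r))"
    by (rule sum.nat_diff_reindex[symmetric])
  also have "\<dots> = (\<Sum>r<Suc (m mod d). - root_term r)"
    by (intro sum.cong refl) (simp add: root_term_reflect)
  also have "\<dots> = - ?S" by (rule sum_negf)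
  finally have "2 * ?S = 0" by (simp only: mult_2 eq_neg_iff_add_eq_0)
  then have "?S = 0" by (simp only: mult_eq_0_iff) simp
  moreover have "(\<Sum>r<R. root_term r) = ?S"
    using assms by (intro sum.mono_neutral_right) (auto simp: root_term_def qratio_w_eq_0[unfolded One_nat_def])
  ultimately show ?thesis by simp
qed

text \<open>At \<open>z\<close> each block is a multiple of a sum of \<open>root_term\<close>. A
  final incomplete block vanishes too, provided it contains the index
  \<open>m mod d\<close>.\<close>

lemma val_sum_blocks:
  assumes "R \<le> d" "R = 0 \<or> m mod d < R"
  shows "has_val z (\<Sum>k<J * d + R. (1 - p ^ (8 * k + 1)) * qratio 1 p k ^ 4 * p ^ (2 * k)) 0"
proof -
  let ?f = "\<lambda>k. (1 - p ^ (8 * k + 1)) * qratio 1 p k ^ 4 * p ^ (2 * k)"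
  obtain C where C: "\<And>j r. r < d \<Longrightarrow> has_val z (qratio 1 p (j * d + r)) (C j * qratio 1 w r)"
    using val_qratio_blocks[of 1] by blast
  have f: "has_val z (?f (j * d + r)) (C j ^ 4 * root_term r)" if "r < d" for j r
  proof -
    have w: "w ^ (8 * (j * d + r) + 1) = w ^ (8 * r + 1)" "w ^ (2 * (j * d + r)) = w ^ (2 * r)"
    proof -
      have "w ^ (8 * j * d) = 1" "w ^ (2 * j * d) = 1" by (simp_all add: order)
      then show "w ^ (8 * (j * d + r) + 1) = w ^ (8 * r + 1)" "w ^ (2 * (j * d + r)) = w ^ (2 * r)"
        by (simp_all add: power_add distrib_left mult.assoc)
    qed
    have "has_val z (?f (j * d + r))
       ((1 - w ^ (8 * (j * d + r) + 1)) * (C j * qratio 1 w r) ^ 4 * w ^ (2 * (j * d + r)))"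
      by (intro has_val_mult val_one_minus has_val_power val_p C that)
    then show ?thesis unfolding w by (simp add: root_term_def power_mult_distrib mult_ac)
  qed
  have part: "has_val z (\<Sum>r<R. ?f (j * d + r)) 0" if "R \<le> d" "R = 0 \<or> m mod d < R" for R j
  proof -
    have "has_val z (\<Sum>r<R. ?f (j * d + r)) (\<Sum>r<R. C j ^ 4 * root_term r)"
      using that by (intro has_val_sum f) auto
    also have "(\<Sum>r<R. C j ^ 4 * root_term r) = 0"
      using that(2) sum_root_term[of R] by (auto simp flip: sum_distrib_left)
    finally show ?thesis .
  qed
  have "has_val z (\<Sum>k<J * d. ?f k) 0"
  proof (induction J)
    case (Suc J)
    have "has_val z (\<Sum>k<J * d + d. ?f k) (0 + 0)"
      unfolding sum_lessThan_add using d_gt_1 by (intro has_val_add Suc part) auto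
    then show ?case by (simp add: add.commute)
  qed (simp add: has_val_0)
  then have "has_val z (\<Sum>k<J * d + R. ?f k) (0 + 0)"
    unfolding sum_lessThan_add by (intro has_val_add part assms)
  then show ?thesis by simp
qed

lemma val_truncated_sum:
  assumes "K = m + 1 \<or> K = 4 * m + 1"
  shows "has_val z (\<Sum>k<K. (1 - p ^ (8 * k + 1)) * qratio 1 p k ^ 4 * p ^ (2 * k)) 0"
proof -
  have "m mod d < d" using d_gt_1 by simp
  then have "m mod d + 1 \<le> d" by simp
  from assms show ?thesis
  proof
    assume "K = m + 1"
    \<comment> \<open>The last block ends exactly with the index \<open>m mod d\<close>.\<close>
    then have "K = m div d * d + (m mod d + 1)" by simp
    with \<open>m mod d + 1 \<le> d\<close> show ?thesis using val_sum_blocks[of "m mod d + 1" "m div d"] by (simp only:) simp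
  next
    assume "K = 4 * m + 1"
    then have "K = K div d * d + 0" using d_dvd by simp
    then show ?thesis using val_sum_blocks[of 0 "K div d"] by simp
  qed
qed

text \<open>The fourth power of this quantity is the essential factor of the boundary term in
  \<open>well_poised_telescoping\<close>. Order 1 here gives order 4 there, at every root of unity
  considered.\<close>

lemma ord_boundary:
  assumes "K = m + 1 \<or> K = 4 * m + 1"
  shows "ord_ge z 1 (qratio 1 p K * (1 - p ^ (4 * K)))"
proof -
  obtain c where c: "has_val z (qratio 1 p k) (c k)" for k using val_qratio by metis
  from assms show ?thesis
  proof
    assume K: "K = m + 1"
    have "qratio 1 p K * (1 - p ^ (4 * K)) = qratio 1 p m * (1 - p ^ (4 * m + 1))"
      using qratio_Suc_mult[of p m 1] by (simp add: K p_power_eq_1_iff add.commute)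
    then show ?thesis using ord_ge_val_mult[OF c ord_one_minus[OF d_dvd]] by simp
  next
    assume K: "K = 4 * m + 1"
    then have "d dvd 4 * K" using d_dvd by (intro dvd_mult) (simp only:)
    then show ?thesis by (rule ord_ge_val_mult[OF c ord_one_minus])
  qed
qed

end

section \<open>Sums over roots of unity\<close>

lemma sum_quadratic_times_power:
  fixes u c :: complex
  shows "(1 - u) ^ 3 * (\<Sum>r<N. of_nat r * (c - of_nat r) * u ^ r)
     = u ^ N * ((1 - u) ^ 2 * of_nat N ^ 2 + (2 * u * (1 - u) - c * (1 - u) ^ 2) * of_nat N
          + u * (1 + u - c * (1 - u))) - u * (1 + u - c * (1 - u))"
proof (induction N)
  case (Suc N)
  define t where "t = (of_nat N :: complex)"
  define P where "P = u ^ N"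
  show ?case
    unfolding sum.lessThan_Suc distrib_left Suc power_Suc of_nat_Suc t_def[symmetric] P_def[symmetric]
    by algebra
qed simp

text \<open>The weight \<open>r(n - r)\<close> gives a finite Fourier expansion of
  \<open>u / (1 - u)^2\<close>, so that its sum over roots of unity reduces to geometric
  sums.\<close>

lemma sum_quadratic_root_unity:
  fixes u :: complex
  assumes "u ^ n = 1" "u \<noteq> 1"
  shows "(\<Sum>r<n. of_nat r * (of_nat n - of_nat r) * u ^ r) = 2 * of_nat n * (u / (1 - u) ^ 2)"
proof -
  define S where "S = (\<Sum>r<n. of_nat r * (of_nat n - of_nat r) * u ^ r)"
  have "(1 - u) ^ 3 * S = (1 - u) * (2 * of_nat n * u)"
    unfolding S_def sum_quadratic_times_power assms(1) by algebra
  then have "(1 - u) * ((1 - u) ^ 2 * S - 2 * of_nat n * u) = 0" by algebra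
  then have "(1 - u) ^ 2 * S = 2 * of_nat n * u" using assms(2) by simp
  then show ?thesis unfolding S_def using assms(2) by (simp add: field_simps)
qed

lemma sum_quadratic:
  fixes c :: complex
  shows "(\<Sum>r<N. of_nat r * (c - of_nat r))
     = c * of_nat N * (of_nat N - 1) / 2 - of_nat N * (of_nat N - 1) * (2 * of_nat N - 1) / 6"
  by (induction N) (simp_all add: field_simps)

text \<open>Expand by \<open>sum_quadratic_root_unity\<close> and interchange the sums. For
  \<open>0 < r < n\<close> the inner geometric sum is -1, as its term at \<open>i = 0\<close> is
  missing; for \<open>r = 0\<close> the weight is zero.\<close>

lemma sum_inverse_squares_roots_unity:
  fixes w :: complex
  assumes "n > 0" and order: "\<And>i. w ^ i = 1 \<longleftrightarrow> n dvd i"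
  shows "(\<Sum>i\<in>{1..<n}. w ^ i / (1 - w ^ i) ^ 2) = - (of_nat n ^ 2 - 1) / 12"
proof -
  have wn: "w ^ n = 1" by (simp add: order)
  have geo: "(\<Sum>i\<in>{1..<n}. w ^ (i * r)) = - 1" if "0 < r" "r < n" for r
  proof -
    have "w ^ r \<noteq> 1" unfolding order using that by (auto dest: dvd_imp_le)
    moreover have "(1 - w ^ r) * (\<Sum>i<n. (w ^ r) ^ i) = 0"
      unfolding one_diff_power_eq[symmetric] using wn
      by (simp add: power_mult[symmetric]) (simp add: mult.commute power_mult)
    ultimately have "(\<Sum>i<n. (w ^ r) ^ i) = 0" by simp
    moreover have "{..<n} = insert 0 {1..<n}" using assms(1) by auto
    ultimately have "1 + (\<Sum>i\<in>{1..<n}. (w ^ r) ^ i) = 0" by simp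
    then show ?thesis by (simp add: power_mult[symmetric] mult.commute add_eq_0_iff)
  qed
  have "2 * of_nat n * (\<Sum>i\<in>{1..<n}. w ^ i / (1 - w ^ i) ^ 2)
      = (\<Sum>i\<in>{1..<n}. \<Sum>r<n. of_nat r * (of_nat n - of_nat r) * (w ^ i) ^ r)"
    unfolding sum_distrib_left
  proof (intro sum.cong refl sum_quadratic_root_unity[symmetric])
    fix i assume i: "i \<in> {1..<n}"
    show "(w ^ i) ^ n = 1" by (simp add: order flip: power_mult)
    show "w ^ i \<noteq> 1" unfolding order using i by (auto dest: dvd_imp_le)
  qed
  also have "\<dots> = (\<Sum>r<n. \<Sum>i\<in>{1..<n}. of_nat r * (of_nat n - of_nat r) * (w ^ i) ^ r)"
    by (rule sum.swap)
  also have "\<dots> = (\<Sum>r<n. - (of_nat r * (of_nat n - of_nat r)))"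
  proof (intro sum.cong refl)
    fix r assume "r \<in> {..<n}"
    then show "(\<Sum>i\<in>{1..<n}. of_nat r * (of_nat n - of_nat r) * (w ^ i) ^ r)
        = - (of_nat r * (of_nat n - of_nat r))"
      using geo[of r] by (cases "r = 0") (simp_all flip: sum_distrib_left power_mult)
  qed
  also have "\<dots> = - (of_nat n * (of_nat n ^ 2 - 1) / 6)"
    unfolding sum_negf sum_quadratic by (simp add: field_simps power2_eq_square)
  finally have *: "of_nat n * (2 * (\<Sum>i\<in>{1..<n}. w ^ i / (1 - w ^ i) ^ 2))
      = of_nat n * (- ((of_nat n ^ 2 - 1) / 6))" by (simp add: mult_ac)
  then have "2 * (\<Sum>i\<in>{1..<n}. w ^ i / (1 - w ^ i) ^ 2) = - ((of_nat n ^ 2 - 1) / 6)"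
    using assms(1) by (simp only: mult_cancel_left of_nat_eq_0_iff) simp
  then show ?thesis by (simp add: field_simps)
qed

lemma sum_atLeast1_even_odd:
  fixes f :: "nat \<Rightarrow> 'a::comm_monoid_add"
  shows "(\<Sum>i = 1..2 * N. f i) = (\<Sum>j = 1..N. f (2 * j - 1)) + (\<Sum>j = 1..N. f (2 * j))"
  by (induction N) (simp_all add: add_ac)

text \<open>Since \<open>n = 4m + 1\<close> is odd, the symmetry \<open>i -> n - i\<close> exchanges
  even and odd indices, so the even ones carry half of the full sum. They split into the multiples
  of 4, which come from \<open>D\<close>, and the numbers \<open>4k - 2\<close>, which occur in
  \<open>B(n,q)\<close>.\<close>

lemma sum_even_inverse_squares_roots_unity:
  fixes w :: complex
  assumes order: "\<And>i. w ^ i = 1 \<longleftrightarrow> 4 * m + 1 dvd i"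
  shows "(\<Sum>k = 1..m. w ^ (4 * k) / (1 - w ^ (4 * k)) ^ 2)
       + (\<Sum>k = 1..m. w ^ (4 * k - 2) / (1 - w ^ (4 * k - 2)) ^ 2)
     = - (of_nat (4 * m + 1) ^ 2 - 1) / 24"
proof -
  define h where "h = (\<lambda>i. w ^ i / (1 - w ^ i) ^ 2)"
  have w0: "w \<noteq> 0" using order[of "4 * m + 1"] by auto
  have sym: "h (4 * m + 1 - i) = h i" if "i \<le> 4 * m + 1" for i
  proof -
    have "w ^ (4 * m + 1 - i) = 1 / w ^ i"
      using w0 that order[of "4 * m + 1"] by (subst power_diff) (auto simp only: dvd_refl)
    moreover have "(1 / a) / (1 - 1 / a) ^ 2 = a / (1 - a) ^ 2" if "a \<noteq> 0" for a :: complex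
    proof -
      have "1 - 1 / a = (a - 1) / a" using that by (simp add: field_simps)
      then show ?thesis
        using that by (simp add: power_divide power2_eq_square power2_commute[of 1 a, unfolded power2_eq_square])
    qed
    ultimately show ?thesis unfolding h_def using w0 by simp
  qed
  have "(\<Sum>j = 1..2 * m. h (2 * j - 1)) = (\<Sum>j = 1..2 * m. h (2 * (2 * m + 1 - j) - 1))"
    by (subst sum.atLeastAtMost_rev) simp
  also have "\<dots> = (\<Sum>j = 1..2 * m. h (2 * j))"
  proof (intro sum.cong refl)
    fix j assume "j \<in> {1..2 * m}"
    then have "2 * (2 * m + 1 - j) - 1 = 4 * m + 1 - 2 * j" "2 * j \<le> 4 * m + 1" by auto
    then show "h (2 * (2 * m + 1 - j) - 1) = h (2 * j)" using sym[of "2 * j"] by simp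
  qed
  finally have "(\<Sum>i = 1..2 * (2 * m). h i) = 2 * (\<Sum>j = 1..2 * m. h (2 * j))"
    unfolding sum_atLeast1_even_odd by simp
  moreover have "(\<Sum>i = 1..2 * (2 * m). h i) = - (of_nat (4 * m + 1) ^ 2 - 1) / 12"
  proof -
    have "{1..2 * (2 * m)} = {1..<4 * m + 1}" by auto
    then show ?thesis
      unfolding h_def using sum_inverse_squares_roots_unity[OF _ order] by simp
  qed
  moreover have "(\<Sum>j = 1..2 * m. h (2 * j)) = (\<Sum>j = 1..m. h (4 * j - 2)) + (\<Sum>j = 1..m. h (4 * j))"
    unfolding sum_atLeast1_even_odd by (simp add: diff_mult_distrib2)
  ultimately show ?thesis unfolding h_def by (simp add: field_simps)
qed

section \<open>The sum at a primitive root of unity\<close>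

text \<open>The \<open>\<phi>\<^sub>k(b)\<close> of the overview, written as two well-poised
  quotients with \<open>a = p\<close> and \<open>Q = p^4\<close>.\<close>

definition wpair :: "'a::field \<Rightarrow> 'a \<Rightarrow> nat \<Rightarrow> 'a" where
  "wpair p b k = wp p (p * b) (p ^ 4) k * wp p (p / b) (p ^ 4) k"

lemma vwp_eq_wpair:
  fixes p b x :: "'a::field"
  assumes "p \<noteq> 0" "b \<noteq> 0" "x \<noteq> 0"
  shows "vwp p (p * b) (p / b) (p * x) (p / x) (p ^ 4) k = wpair p b k * wpair p x k * p ^ (2 * k)"
proof -
  have "p ^ 2 * p ^ 4 / (p * b * (p / b) * (p * x) * (p / x)) = p ^ 2"
    using assms by (simp add: field_simps eval_nat_numeral)
  then show ?thesis unfolding vwp_def wpair_def power_mult by (simp only: mult_ac)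
qed

lemma wpair_1:
  fixes p :: "'a::field"
  assumes "p \<noteq> 0"
  shows "wpair p 1 k = qratio 1 p k ^ 2"
  using assms by (simp add: wpair_def wp_def qratio_def power2_eq_square)

lemma wpair_Suc:
  fixes p b :: "'a::field"
  assumes "p \<noteq> 0" "b \<noteq> 0"
  shows "wpair p b (Suc k) = wpair p b k * ((1 - p ^ (4 * k + 1) * b) * (1 - p ^ (4 * k + 1) / b)
     / ((1 - p ^ (4 * k + 4) * b) * (1 - p ^ (4 * k + 4) / b)))"
proof -
  have 1: "p * p ^ 4 * (p ^ 4) ^ k / (p * b) = p ^ (4 * k + 4) / b"
    "p * p ^ 4 * (p ^ 4) ^ k / (p / b) = p ^ (4 * k + 4) * b"
    "p * b * (p ^ 4) ^ k = p ^ (4 * k + 1) * b" "p / b * (p ^ 4) ^ k = p ^ (4 * k + 1) / b"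
    using assms by (simp_all add: power_add mult_ac flip: power_mult)
  show ?thesis
    unfolding wpair_def wp_Suc 1 by (simp add: mult_ac)
qed

text \<open>The product depends on \<open>x\<close> only through \<open>(1 - x)^2 / x\<close>, so
  passing from 1 to \<open>x\<close> is a change of second order.\<close>

lemma one_minus_pair:
  fixes c x :: "'a::field"
  assumes "x \<noteq> 0"
  shows "(1 - c * x) * (1 - c / x) = (1 - c) ^ 2 - c / x * (1 - x) ^ 2"
  using assms by (simp add: field_simps power2_eq_square)

locale primitive_root_point = root_of_unity_point z w p e "4 * m + 1" m
  for z w p e m
begin

definition x :: "complex poly fract" where
  "x = p ^ (4 * m + 1)"

section \<open>Symmetric pairs of factors modulo the square of \<open>1 - x\<close>\<close>

lemma x_nonzero: "x \<noteq> 0"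
  using p_nonzero by (simp add: x_def)

lemma ord_one_minus_x: "ord_ge z 1 (1 - x)"
  unfolding x_def by (rule ord_one_minus) simp

lemma ord_one_minus_x_sq: "ord_ge z 2 ((1 - x) ^ 2)"
  using ord_ge_power[OF ord_one_minus_x, of 2] by simp

lemma val_x: "has_val z x 1"
  using val_p_power[of "4 * m + 1"] order[of "4 * m + 1"] by (simp add: x_def)

lemma w_power_4_neq_1: "0 < i \<Longrightarrow> i < 4 * m + 1 \<Longrightarrow> w ^ (4 * i) \<noteq> 1"
  using dvd_4_mult_imp_dvd[of i] nat_dvd_not_less[of i "4 * m + 1"] order by auto

text \<open>The trivial factors \<open>1\<close> are kept so that the second statement matches the
  factors of \<open>wpair_Suc\<close> at \<open>b = 1\<close>.\<close>

lemma val_pair: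
  "has_val z ((1 - p ^ i * x) * (1 - p ^ i / x)) ((1 - w ^ i) ^ 2)"
  "has_val z ((1 - p ^ i * 1) * (1 - p ^ i / 1)) ((1 - w ^ i) ^ 2)"
proof -
  have "has_val z ((1 - p ^ i * x) * (1 - p ^ i / x)) ((1 - w ^ i * 1) * (1 - w ^ i / 1))"
    by (intro has_val_intros has_val_divide val_p_power val_x val_p) simp
  then show "has_val z ((1 - p ^ i * x) * (1 - p ^ i / x)) ((1 - w ^ i) ^ 2)"
    by (simp add: power2_eq_square)
  show "has_val z ((1 - p ^ i * 1) * (1 - p ^ i / 1)) ((1 - w ^ i) ^ 2)"
    using has_val_power[OF val_one_minus, of i 2] by (simp add: power2_eq_square)
qed

lemma ord_pair_diff:
  "ord_ge z 2 ((1 - p ^ i * 1) * (1 - p ^ i / 1) - (1 - p ^ i * x) * (1 - p ^ i / x))"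
proof -
  have "(1 - p ^ i * 1) * (1 - p ^ i / 1) - (1 - p ^ i * x) * (1 - p ^ i / x) = p ^ i / x * (1 - x) ^ 2"
    unfolding one_minus_pair[OF x_nonzero] by (simp add: power2_eq_square)
  moreover have "has_val z (p ^ i / x) (w ^ i / 1)"
    by (intro has_val_divide val_p_power val_x) simp
  ultimately show ?thesis using ord_ge_val_mult[OF _ ord_one_minus_x_sq] by (simp only:)
qed

text \<open>Product and quotient rule along \<open>wpair_Suc\<close>: every numerator and
  denominator changes by order 2, and \<open>k < 4 * m + 1\<close> keeps the denominators nonzero at
  \<open>z\<close>.\<close>

lemma ord_wpair_diff:
  "k < 4 * m + 1 \<Longrightarrow> ord_ge z 2 (wpair p 1 k - wpair p x k) \<and> (\<exists>c. has_val z (wpair p x k) c)"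
proof (induction k)
  case 0
  then show ?case using has_val_1 by (auto simp: wpair_def intro: ord_ge_zero)
next
  case (Suc k)
  define N where "N b = (1 - p ^ (4 * k + 1) * b) * (1 - p ^ (4 * k + 1) / b)" for b
  define D where "D b = (1 - p ^ (4 * k + 4) * b) * (1 - p ^ (4 * k + 4) / b)" for b
  define \<nu> where "\<nu> = (1 - w ^ (4 * k + 1)) ^ 2"
  define \<delta> where "\<delta> = (1 - w ^ (4 * k + 4)) ^ 2"
  have "\<delta> \<noteq> 0" using w_power_4_neq_1[of "k + 1"] Suc.prems by (simp add: \<delta>_def algebra_simps)
  have N: "has_val z (N 1) \<nu>" "has_val z (N x) \<nu>" and D: "has_val z (D 1) \<delta>" "has_val z (D x) \<delta>"
    unfolding N_def D_def \<nu>_def \<delta>_def by (rule val_pair)+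
  have D0: "D 1 \<noteq> 0" "D x \<noteq> 0" using has_val_nonzero D \<open>\<delta> \<noteq> 0\<close> by blast+
  have ND: "ord_ge z 2 (N 1 - N x)" "ord_ge z 2 (D 1 - D x)"
    unfolding N_def D_def by (rule ord_pair_diff)+
  have "ord_ge z 2 (((N 1 - N x) * D x - (D 1 - D x) * N x) * (1 / (D 1 * D x)))"
    by (rule ord_ge_mult_val[OF ord_ge_diff[OF ord_ge_mult_val[OF ND(1) D(2)] ord_ge_mult_val[OF ND(2) N(2)]]
        has_val_divide[OF has_val_1 has_val_mult[OF D]]]) (use \<open>\<delta> \<noteq> 0\<close> in simp)
  also have "((N 1 - N x) * D x - (D 1 - D x) * N x) * (1 / (D 1 * D x)) = N 1 / D 1 - N x / D x"
    using D0 by (simp add: field_simps)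
  finally have quot: "ord_ge z 2 (N 1 / D 1 - N x / D x)" .
  obtain c where c: "has_val z (wpair p x k) c" and o: "ord_ge z 2 (wpair p 1 k - wpair p x k)"
    using Suc by auto
  have S: "wpair p b (Suc k) = wpair p b k * (N b / D b)" if "b \<noteq> 0" for b
    unfolding N_def D_def using wpair_Suc[OF p_nonzero that] .
  have "wpair p 1 (Suc k) - wpair p x (Suc k)
     = (wpair p 1 k - wpair p x k) * (N 1 / D 1) + wpair p x k * (N 1 / D 1 - N x / D x)"
    using S[of 1] S[OF x_nonzero] by (simp add: algebra_simps)
  moreover have "ord_ge z 2 ((wpair p 1 k - wpair p x k) * (N 1 / D 1) + wpair p x k * (N 1 / D 1 - N x / D x))"
    by (intro ord_ge_add ord_ge_mult_val[OF o has_val_divide[OF N(1) D(1)]] ord_ge_val_mult[OF c quot]) fact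
  moreover have "has_val z (wpair p x (Suc k)) (c * (\<nu> / \<delta>))"
    unfolding S[OF x_nonzero] using \<open>\<delta> \<noteq> 0\<close> by (intro has_val_mult c has_val_divide N D)
  ultimately show ?case by auto
qed

text \<open>This rules out zero denominators when \<open>vwp_sum_shift\<close> is applied. For the
  first part, \<open>4i + 5\<close> is odd while \<open>p * x\<close> has the even exponent
  \<open>4m + 2\<close>.\<close>

lemma nonvanishing:
  "p ^ (4 * i + 5) \<noteq> p * x" "p ^ (4 * i + 5) \<noteq> p / x"
proof -
  have "4 * i + 5 \<noteq> Suc (4 * m + 1)" by presburger
  then show "p ^ (4 * i + 5) \<noteq> p * x"
    unfolding x_def power_Suc[symmetric] p_power_eq_iff .
  have "p ^ (4 * i + 5 + (4 * m + 1)) \<noteq> p ^ 1" unfolding p_power_eq_iff by simp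
  then have "p ^ (4 * i + 5) * x \<noteq> p" unfolding x_def power_add by simp
  then show "p ^ (4 * i + 5) \<noteq> p / x"
    using x_nonzero by (simp add: nonzero_eq_divide_eq)
qed

text \<open>Up to the factor \<open>1 - p\<close>, this is \<open>F(b,x)\<close> after
  \<open>j\<close> parameter shifts: \<open>a\<close>, \<open>d\<close> and \<open>e\<close> have
  been multiplied by \<open>p^(4j)\<close>, while \<open>pb\<close> and \<open>p/b\<close> are
  unchanged.\<close>

definition shifted_sum :: "nat \<Rightarrow> complex poly fract \<Rightarrow> nat \<Rightarrow> complex poly fract" where
  "shifted_sum K b j = (\<Sum>k<K. (1 - p ^ (4 * j + 1) * (p ^ 4) ^ (2 * k))
     * vwp (p ^ (4 * j + 1)) (p * b) (p / b) (x * p ^ (4 * j + 1)) (p ^ (4 * j + 1) / x) (p ^ 4) k)"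

text \<open>An instance of \<open>vwp_sum_shift\<close> with \<open>N = m - j\<close>. Apart from
  the sums, \<open>b\<close> enters only the last two denominators, and the inhomogeneous term
  contains \<open>(1 - x)^2\<close>; the comparison of \<open>b = x\<close> with
  \<open>b = 1\<close> rests on these two facts.\<close>

lemma shifted_sum_Suc:
  assumes "j < m" "m < K" "b = 1 \<or> b = x"
  shows "shifted_sum K b j
     = (1 - 1 / x) * (1 - x) / (1 - 1 / p ^ (4 * j + 1))
       + (1 - p ^ (4 * j + 3)) * (1 - x * p ^ (4 * j + 1)) * (1 - p ^ (4 * j + 1) / x) / (1 - p ^ (4 * j + 1))
          / ((1 - p ^ (4 * j + 4) * b) * (1 - p ^ (4 * j + 4) / b)) * shifted_sum K b (Suc j)"
proof -
  define a where "a = p ^ (4 * j + 1)"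
  define Q where "Q = p ^ 4"
  have b0: "b \<noteq> 0" using assms(3) x_nonzero by auto
  have a0: "a \<noteq> 0" "Q \<noteq> 0" using p_nonzero by (simp_all add: a_def Q_def)
  have aQ: "a * Q ^ i = p ^ (4 * j + 4 * i + 1)" for i
    by (simp add: a_def Q_def power_add flip: power_mult)
  have aQS: "a * Q ^ Suc i = p ^ (4 * (j + i) + 5)" for i
    unfolding aQ by (simp add: algebra_simps)
  have a1: "a \<noteq> 1" unfolding a_def p_power_eq_1_iff by simp
  have nv: "a * Q ^ Suc i \<noteq> p * b" "a * Q ^ Suc i \<noteq> p / b" for i
  proof -
    have "p ^ (4 * (j + i) + 5) \<noteq> p ^ 1" unfolding p_power_eq_iff by simp
    then show "a * Q ^ Suc i \<noteq> p * b" "a * Q ^ Suc i \<noteq> p / b"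
      unfolding aQS using assms(3) nonvanishing[of "j + i"] by auto
  qed
  have nv': "a * Q ^ Suc i \<noteq> x * a" "a * Q ^ Suc i \<noteq> a / x" for i
  proof -
    have "4 * Suc i \<noteq> 4 * m + 1" by presburger
    then have "Q ^ Suc i \<noteq> x" unfolding x_def Q_def power_mult[symmetric] p_power_eq_iff .
    then show "a * Q ^ Suc i \<noteq> x * a" using a0 by (simp add: mult.commute[of x])
    have "p ^ (4 * Suc i + (4 * m + 1)) \<noteq> 1" unfolding p_power_eq_1_iff by simp
    then have "Q ^ Suc i * x \<noteq> 1" by (simp only: Q_def x_def power_add power_mult not_False_eq_True)
    then show "a * Q ^ Suc i \<noteq> a / x"
      using a0 x_nonzero by (simp add: nonzero_eq_divide_eq mult.assoc del: power_Suc)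
  qed
  have N: "a / x * Q ^ (m - j) = 1"
  proof -
    have "4 * j + 4 * (m - j) + 1 = 4 * m + 1" using assms(1) by simp
    then have "a * Q ^ (m - j) = x" unfolding aQ x_def by (simp only:)
    then show ?thesis using x_nonzero by simp
  qed
  have s1: "(1 - a / (x * a)) * (1 - a / (a / x)) / (1 - a / (x * a * (a / x)))
      = (1 - 1 / x) * (1 - x) / (1 - 1 / a)"
    using a0 x_nonzero by simp
  have aQ': "a * Q = p * p ^ (4 * j + 4)" "a * Q = p * p * p ^ (4 * j + 3)"
    by (simp_all add: a_def Q_def eval_nat_numeral mult_ac)
  have s2: "a * Q / (p * b * (p / b)) = p ^ (4 * j + 3)" "x * a * (a / x) / a = a"
     "a * Q / (p * b) = p ^ (4 * j + 4) / b" "a * Q / (p / b) = p ^ (4 * j + 4) * b"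
  proof -
    have "p * b * (p / b) = p * p" using b0 by simp
    then show "a * Q / (p * b * (p / b)) = p ^ (4 * j + 3)"
      unfolding aQ'(2) using p_nonzero by simp
  qed (use a0 x_nonzero b0 p_nonzero in \<open>simp_all add: aQ'(1)\<close>)
  have aQ1: "p ^ (4 * Suc j + 1) = a * Q"
    using aQ[of 1] by (simp add: add.commute)
  have SS: "shifted_sum K b (Suc j) = (\<Sum>k<K. (1 - a * Q * Q ^ (2 * k))
     * vwp (a * Q) (p * b) (p / b) (x * a * Q) (a / x * Q) Q k)"
    and S: "shifted_sum K b j = (\<Sum>k<K. (1 - a * Q ^ (2 * k)) * vwp a (p * b) (p / b) (x * a) (a / x) Q k)"
    unfolding shifted_sum_def aQ1 unfolding a_def[symmetric] Q_def[symmetric] by (simp_all add: mult.assoc)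
  show ?thesis
    unfolding SS unfolding S a_def[symmetric]
    using vwp_sum_shift[of a Q "p * b" "p / b" "x * a" "a / x" "m - j" K] a0 b0 p_nonzero x_nonzero
      nv nv' N a1 assms(2)
    unfolding s1 s2 by (simp add: mult_ac)
qed

end

lemma sum_vwp_last_1:
  fixes a b c d Q :: "'a::field"
  assumes "K > 0"
  shows "(\<Sum>k<K. (1 - a * Q ^ (2 * k)) * vwp a b c d 1 Q k) = 1 - a"
proof -
  have "vwp a b c d 1 Q k = 0" if "k > 0" for k
    using qpoch_eq_0[of 1 Q 0 k] that by (simp add: vwp_def wp_def)
  then have "(\<Sum>k<K. (1 - a * Q ^ (2 * k)) * vwp a b c d 1 Q k)
      = (\<Sum>k<K. if k = 0 then 1 - a else 0)"
    by (intro sum.cong refl) (auto simp: vwp_def)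
  then show ?thesis using assms by simp
qed

section \<open>Closed form of \<open>F(1,x)\<close>\<close>

context primitive_root_point
begin

text \<open>After \<open>m\<close> shifts the base parameter is \<open>x\<close> and the last
  parameter is 1, so only the term \<open>k = 0\<close> remains.\<close>

lemma shifted_sum_m:
  assumes "m < K"
  shows "shifted_sum K b m = 1 - x"
  using sum_vwp_last_1[of K x "p ^ 4" "p * b" "p / b" "x * x"] assms x_nonzero
  by (simp only: shifted_sum_def x_def[symmetric] divide_self) simp

text \<open>
  For \<open>j = 0\<close> this agrees with \<^const>\<open>shifted_sum\<close> at \<open>b = 1\<close>, but here the shifted parameter \<open>d\<close> is equal
  to the base parameter \<open>a\<close>, which makes the inhomogeneous term of the recursion vanish.
\<close>

definition summable_sum :: "nat \<Rightarrow> nat \<Rightarrow> complex poly fract" where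
  "summable_sum K j = (\<Sum>k<K. (1 - p ^ (4 * j + 1) * (p ^ 4) ^ (2 * k))
     * vwp (p ^ (4 * j + 1)) p (p * x) (p ^ (4 * j + 1)) (p ^ (4 * j + 1) / x) (p ^ 4) k)"

lemma summable_sum_m:
  assumes "m < K"
  shows "summable_sum K m = 1 - x"
  using sum_vwp_last_1[of K x "p ^ 4" "p" "p * x" "x"] assms x_nonzero
  by (simp only: summable_sum_def x_def[symmetric] divide_self) simp

text \<open>With \<open>d = a\<close> the inhomogeneous term is zero, and \<open>1 - e\<close>
  cancels against \<open>1 - de/a\<close>. The bound \<open>j < m\<close> ensures that
  \<open>e = a/x\<close> differs from 1.\<close>

lemma summable_sum_Suc:
  assumes "j < m" "m < K"
  shows "summable_sum K j
     = (1 - p ^ (4 * j + 3) / x) / (1 - p ^ (4 * j + 4) / x)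
       * ((1 - p ^ (4 * j + 1)) / (1 - p ^ (4 * j + 4))) * summable_sum K (Suc j)"
proof -
  define a where "a = p ^ (4 * j + 1)"
  define Q where "Q = p ^ 4"
  have a0: "a \<noteq> 0" "Q \<noteq> 0" using p_nonzero by (simp_all add: a_def Q_def)
  have aQ: "a * Q ^ i = p ^ (4 * j + 4 * i + 1)" for i
    by (simp add: a_def Q_def power_add flip: power_mult)
  have aQS: "a * Q ^ Suc i = p ^ (4 * (j + i) + 5)" for i
    unfolding aQ by (simp add: algebra_simps)
  have nv: "a * Q ^ Suc i \<noteq> p" "a * Q ^ Suc i \<noteq> p * x" for i
  proof -
    have "p ^ (4 * (j + i) + 5) \<noteq> p ^ 1" unfolding p_power_eq_iff by simp
    then show "a * Q ^ Suc i \<noteq> p" "a * Q ^ Suc i \<noteq> p * x"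
      unfolding aQS using nonvanishing[of "j + i"] by auto
  qed
  have nv': "a * Q ^ Suc i \<noteq> a" "a * Q ^ Suc i \<noteq> a / x" for i
  proof -
    have "Q ^ Suc i \<noteq> 1" unfolding Q_def power_mult[symmetric] p_power_eq_1_iff by simp
    then show "a * Q ^ Suc i \<noteq> a" using a0 by simp
    have "p ^ (4 * Suc i + (4 * m + 1)) \<noteq> 1" unfolding p_power_eq_1_iff by simp
    then have "Q ^ Suc i * x \<noteq> 1" by (simp only: Q_def x_def power_add power_mult not_False_eq_True)
    then show "a * Q ^ Suc i \<noteq> a / x"
      using a0 x_nonzero by (simp add: nonzero_eq_divide_eq mult.assoc del: power_Suc)
  qed
  have N: "a / x * Q ^ (m - j) = 1"
  proof -
    have "4 * j + 4 * (m - j) + 1 = 4 * m + 1" using assms(1) by simp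
    then have "a * Q ^ (m - j) = x" unfolding aQ x_def by (simp only:)
    then show ?thesis using x_nonzero by simp
  qed
  have e1: "a / x \<noteq> 1"
  proof -
    have "a \<noteq> x" unfolding a_def x_def p_power_eq_iff using assms(1) by simp
    then show ?thesis using x_nonzero by simp
  qed
  have aQ': "a * Q = p * p ^ (4 * j + 4)" "a * Q = p * p * p ^ (4 * j + 3)"
    by (simp_all add: a_def Q_def eval_nat_numeral mult_ac)
  have s2: "a * Q / (p * (p * x)) = p ^ (4 * j + 3) / x" "a * (a / x) / a = a / x"
     "a * Q / p = p ^ (4 * j + 4)" "a * Q / (p * x) = p ^ (4 * j + 4) / x"
  proof -
    show "a * Q / (p * (p * x)) = p ^ (4 * j + 3) / x"
      unfolding aQ'(2) using p_nonzero by (simp add: mult.assoc)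
  qed (use a0 x_nonzero p_nonzero in \<open>simp_all add: aQ'(1)\<close>)
  have aQ1: "p ^ (4 * Suc j + 1) = a * Q"
    using aQ[of 1] by (simp add: add.commute)
  have SS: "summable_sum K (Suc j) = (\<Sum>k<K. (1 - a * Q * Q ^ (2 * k))
     * vwp (a * Q) p (p * x) (a * Q) (a / x * Q) Q k)"
    and S: "summable_sum K j = (\<Sum>k<K. (1 - a * Q ^ (2 * k)) * vwp a p (p * x) a (a / x) Q k)"
    unfolding summable_sum_def aQ1 unfolding a_def[symmetric] Q_def[symmetric] by simp_all
  have e2: "a * (a / x) \<noteq> a" and mj: "m - j < K"
    using e1 a0 assms by (auto simp only: mult_cancel_left2)
  have "summable_sum K j = (1 - p ^ (4 * j + 3) / x) * (1 - a) * (1 - a / x)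
      / ((1 - a / x) * (1 - p ^ (4 * j + 4)) * (1 - p ^ (4 * j + 4) / x)) * summable_sum K (Suc j)"
    unfolding SS unfolding S
    using vwp_sum_shift[of a Q p "p * x" a "a / x" "m - j" K] a0 p_nonzero x_nonzero
      nv nv' N e1 e2[unfolded times_divide_eq_right] mj
    unfolding s2 by simp
  then show ?thesis unfolding a_def[symmetric] using e1 x_nonzero by (simp add: mult_ac)
qed

lemma summable_sum_0:
  assumes "m < K"
  shows "summable_sum K 0 = (1 - x) * (inverse p ^ m * qratio 2 p m)"
proof -
  let ?g = "\<lambda>j. (1 - p ^ (4 * j + 3) / x) / (1 - p ^ (4 * j + 4) / x)"
  let ?h = "\<lambda>j. (1 - p ^ (4 * j + 1)) / (1 - p ^ (4 * j + 4))"
  have "summable_sum K 0 = (\<Prod>j<i. ?g j * ?h j) * summable_sum K i" if "i \<le> m" for i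
    using that by (induction i) (use summable_sum_Suc[OF _ assms] in \<open>simp_all add: mult_ac\<close>)
  from this[of m] have "summable_sum K 0 = (\<Prod>j<m. ?g j) * (\<Prod>j<m. ?h j) * (1 - x)"
    using summable_sum_m[OF assms] by (simp only: prod.distrib)
  \<comment> \<open>Reversal turns \<open>p^(4j+3) / x\<close> and \<open>p^(4j+4) / x\<close> into
    the inverses of \<open>p^(4j+2)\<close> and \<open>p^(4j+1)\<close>. The new denominators then
    cancel the numerators of \<open>?h\<close>.\<close>
  also have "(\<Prod>j<m. ?g j) = (\<Prod>j<m. ?g (m - Suc j))"
    by (rule prod.nat_diff_reindex[symmetric])
  also have "\<dots> = (\<Prod>j<m. inverse p * ((1 - p ^ (4 * j + 2)) / (1 - p ^ (4 * j + 1))))"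
  proof (intro prod.cong refl)
    fix j assume "j \<in> {..<m}"
    then have "4 * (m - Suc j) + 3 + (4 * j + 2) = 4 * m + 1" "4 * (m - Suc j) + 4 + (4 * j + 1) = 4 * m + 1"
      by auto
    then have "p ^ (4 * (m - Suc j) + 3) * p ^ (4 * j + 2) = x" "p ^ (4 * (m - Suc j) + 4) * p ^ (4 * j + 1) = x"
      unfolding x_def power_add[symmetric] by (simp_all only:)
    then have eq: "p ^ (4 * (m - Suc j) + 3) / x = 1 / p ^ (4 * j + 2)"
      "p ^ (4 * (m - Suc j) + 4) / x = 1 / p ^ (4 * j + 1)"
      using p_nonzero x_nonzero by (simp_all add: frac_eq_eq)
    define c where "c = p ^ (4 * j + 1)"
    have c: "c \<noteq> 0" "p ^ (4 * j + 2) = p * c" "c \<noteq> 1"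
      using p_nonzero p_power_eq_1_iff[of "4 * j + 1"] by (simp_all add: c_def)
    show "?g (m - Suc j) = inverse p * ((1 - p ^ (4 * j + 2)) / (1 - p ^ (4 * j + 1)))"
      unfolding eq c(2) c_def[symmetric] using c p_nonzero by (simp add: divide_simps) (simp add: algebra_simps)
  qed
  also have "\<dots> * (\<Prod>j<m. ?h j) = (\<Prod>j<m. inverse p * ((1 - p ^ (4 * j + 2)) / (1 - p ^ (4 * j + 4))))"
    unfolding prod.distrib[symmetric]
  proof (intro prod.cong refl)
    fix j
    have "1 - p ^ (4 * j + 1) \<noteq> 0" using p_power_eq_1_iff[of "4 * j + 1"] by simp
    then show "inverse p * ((1 - p ^ (4 * j + 2)) / (1 - p ^ (4 * j + 1))) * ?h j
        = inverse p * ((1 - p ^ (4 * j + 2)) / (1 - p ^ (4 * j + 4)))" by simp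
  qed
  also have "\<dots> = inverse p ^ m * qratio 2 p m"
    unfolding prod.distrib qratio_eq_prod by simp
  finally show ?thesis by (simp add: mult.commute)
qed

text \<open>The quotient of the \<open>b\<close>-dependent denominators in
  \<open>shifted_sum_Suc\<close>, at \<open>b = 1\<close> over \<open>b = x\<close>. The
  \<open>D\<close> of the overview is the product of these over \<open>i < m\<close>.\<close>

definition rho :: "nat \<Rightarrow> complex poly fract" where
  "rho i = (1 - p ^ (4 * i + 4)) ^ 2 / ((1 - p ^ (4 * i + 4) * x) * (1 - p ^ (4 * i + 4) / x))"

section \<open>Comparison of \<open>F(x,x)\<close> with \<open>F(1,x)\<close>\<close>

lemma val_denominator_nonzero: "i < m \<Longrightarrow> (1 - w ^ (4 * i + 4)) ^ 2 \<noteq> 0"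
  using w_power_4_neq_1[of "i + 1"] by (simp add: algebra_simps)

lemma rho_expand:
  assumes "i < m"
  shows "\<exists>r. rho i = 1 + (1 - x) ^ 2 * r \<and> has_val z r (w ^ (4 * i + 4) / (1 - w ^ (4 * i + 4)) ^ 2)"
proof -
  define c where "c = p ^ (4 * i + 4)"
  define P where "P = (1 - c * x) * (1 - c / x)"
  have P: "has_val z P ((1 - w ^ (4 * i + 4)) ^ 2)"
    unfolding P_def c_def by (rule val_pair)
  then have P0: "P \<noteq> 0" using val_denominator_nonzero[OF assms] by (rule has_val_nonzero)
  have "(1 - c) ^ 2 = P + (1 - x) ^ 2 * (c / x)"
    unfolding P_def one_minus_pair[OF x_nonzero] by simp
  then have "rho i = 1 + (1 - x) ^ 2 * (c / x / P)"
    unfolding rho_def c_def[symmetric] P_def[symmetric] using P0 by (simp add: add_divide_distrib)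
  moreover have "has_val z (c / x / P) (w ^ (4 * i + 4) / 1 / (1 - w ^ (4 * i + 4)) ^ 2)"
    unfolding c_def by (intro has_val_divide val_p_power val_x P val_denominator_nonzero assms) simp
  ultimately show ?thesis by (intro exI[of _ "c / x / P"]) simp
qed

text \<open>To first order in \<open>(1 - x)^2\<close> the coefficients of the factors add up; the
  value at \<open>z\<close> is kept for the later cancellation with \<open>B(n,q)\<close>. The lower
  limit \<open>j\<close> is general for the induction in \<open>shifted_sum_compare\<close>.\<close>

lemma prod_rho_expand:
  "j \<le> m \<Longrightarrow> \<exists>E. (\<Prod>i\<in>{j..<m}. rho i) = 1 + (1 - x) ^ 2 * E
     \<and> has_val z E (\<Sum>i\<in>{j..<m}. w ^ (4 * i + 4) / (1 - w ^ (4 * i + 4)) ^ 2)"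
proof (induction rule: inc_induct)
  case base
  show ?case by (intro exI[of _ 0]) (simp add: has_val_0)
next
  case (step j)
  obtain E where E: "(\<Prod>i\<in>{Suc j..<m}. rho i) = 1 + (1 - x) ^ 2 * E"
     "has_val z E (\<Sum>i\<in>{Suc j..<m}. w ^ (4 * i + 4) / (1 - w ^ (4 * i + 4)) ^ 2)"
    using step by blast
  obtain r where r: "rho j = 1 + (1 - x) ^ 2 * r"
     "has_val z r (w ^ (4 * j + 4) / (1 - w ^ (4 * j + 4)) ^ 2)"
    using rho_expand[of j] step by auto
  have "(\<Prod>i\<in>{j..<m}. rho i) = 1 + (1 - x) ^ 2 * (r + E + (1 - x) ^ 2 * r * E)"
    using step by (simp add: prod.atLeast_Suc_lessThan E r algebra_simps)
  moreover have "has_val z (r + E + (1 - x) ^ 2 * r * E)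
     (w ^ (4 * j + 4) / (1 - w ^ (4 * j + 4)) ^ 2
       + (\<Sum>i\<in>{Suc j..<m}. w ^ (4 * i + 4) / (1 - w ^ (4 * i + 4)) ^ 2)
      + (1 - 1) ^ 2 * (w ^ (4 * j + 4) / (1 - w ^ (4 * j + 4)) ^ 2)
         * (\<Sum>i\<in>{Suc j..<m}. w ^ (4 * i + 4) / (1 - w ^ (4 * i + 4)) ^ 2))"
    by (intro has_val_add has_val_mult has_val_power has_val_diff has_val_1 val_x E r)
  ultimately show ?case
    using step by (intro exI[of _ "r + E + (1 - x) ^ 2 * r * E"]) (simp add: sum.atLeast_Suc_lessThan)
qed

text \<open>Downward induction from \<open>j = m\<close>, where both sums are \<open>1 - x\<close>.
  The two recursions share the inhomogeneous term \<open>u\<close>, so the difference is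
  \<open>u\<close> times 1 minus the product of \<open>rho\<close>, plus a regular multiple of the
  difference at \<open>j + 1\<close>. Both factors of the first term have order 2.\<close>

lemma shifted_sum_compare:
  assumes "m < K"
  shows "j \<le> m \<Longrightarrow> ord_ge z 4 (shifted_sum K x j - (\<Prod>i\<in>{j..<m}. rho i) * shifted_sum K 1 j)"
proof (induction rule: inc_induct)
  case base
  show ?case using assms by (simp add: shifted_sum_m ord_ge_zero)
next
  case (step j)
  define c where "c = (1 - p ^ (4 * j + 3)) * (1 - x * p ^ (4 * j + 1)) * (1 - p ^ (4 * j + 1) / x)
      / (1 - p ^ (4 * j + 1))"
  define u where "u = (1 - 1 / x) * (1 - x) / (1 - 1 / p ^ (4 * j + 1))"
  define P where "P = (1 - p ^ (4 * j + 4) * x) * (1 - p ^ (4 * j + 4) / x)"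
  define D where "D = (\<Prod>i\<in>{Suc j..<m}. rho i)"
  have w1: "1 - w ^ (4 * j + 1) \<noteq> 0"
    using order[of "4 * j + 1"] step nat_dvd_not_less[of "4 * j + 1" "4 * m + 1"] by auto
  have P: "has_val z P ((1 - w ^ (4 * j + 4)) ^ 2)"
    unfolding P_def by (rule val_pair)
  have q0: "1 - p ^ (4 * j + 4) \<noteq> 0" using p_power_eq_1_iff[of "4 * j + 4"] by simp
  have "has_val z c ((1 - w ^ (4 * j + 3)) * (1 - 1 * w ^ (4 * j + 1)) * (1 - w ^ (4 * j + 1) / 1)
      / (1 - w ^ (4 * j + 1)))"
    unfolding c_def by (intro has_val_divide has_val_mult has_val_diff has_val_1 val_p_power val_x w1) simp
  then obtain c' where cP: "has_val z (c / P) c'"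
    using has_val_divide[OF _ P val_denominator_nonzero] step by auto
  have u: "ord_ge z 2 u"
  proof -
    have eq: "u = (1 - x) ^ 2 * (- (1 / x) * (1 / (1 - 1 / p ^ (4 * j + 1))))"
    proof -
      have "(1 - 1 / x) * (1 - x) = (1 - x) ^ 2 * (- (1 / x))"
        using x_nonzero by (simp add: field_simps power2_eq_square)
      then show ?thesis unfolding u_def by simp
    qed
    have "1 - 1 / w ^ (4 * j + 1) \<noteq> 0" using w1 w_nonzero by simp
    then have "has_val z (- (1 / x) * (1 / (1 - 1 / p ^ (4 * j + 1)))) (- (1 / 1) * (1 / (1 - 1 / w ^ (4 * j + 1))))"
      using w_nonzero
      by (intro has_val_mult has_val_minus has_val_divide has_val_diff has_val_1 val_p_power val_x) auto
    then show ?thesis unfolding eq by (rule ord_ge_mult_val[OF ord_one_minus_x_sq])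
  qed
  obtain E y where E: "(\<Prod>i\<in>{j..<m}. rho i) = 1 + (1 - x) ^ 2 * E" "has_val z E y"
    using prod_rho_expand[of j] step by auto
  have rho: "rho j * (1 / ((1 - p ^ (4 * j + 4) * 1) * (1 - p ^ (4 * j + 4) / 1))) = 1 / P"
    unfolding rho_def P_def using q0 by (simp add: power2_eq_square)
  have Dj: "(\<Prod>i\<in>{j..<m}. rho i) = rho j * D"
    using step by (simp add: prod.atLeast_Suc_lessThan D_def)
  have Sx: "shifted_sum K x j = u + c * (1 / P) * shifted_sum K x (Suc j)"
    using shifted_sum_Suc[of j K x] step assms by (simp add: u_def c_def P_def)
  have S1: "shifted_sum K 1 j
      = u + c * (1 / ((1 - p ^ (4 * j + 4) * 1) * (1 - p ^ (4 * j + 4) / 1))) * shifted_sum K 1 (Suc j)"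
    using shifted_sum_Suc[of j K 1] step assms by (simp add: u_def c_def)
  have "shifted_sum K x j - (\<Prod>i\<in>{j..<m}. rho i) * shifted_sum K 1 j
      = u * (1 - (\<Prod>i\<in>{j..<m}. rho i)) + c * (1 / P) * shifted_sum K x (Suc j)
        - c * (rho j * (1 / ((1 - p ^ (4 * j + 4) * 1) * (1 - p ^ (4 * j + 4) / 1)))) * D * shifted_sum K 1 (Suc j)"
  proof -
    have "(u + c * a * s) - r * D * (u + c * b * t) = u * (1 - r * D) + c * a * s - c * (r * b) * D * t"
      for a b r s t by (simp add: algebra_simps)
    then show ?thesis unfolding Sx S1 Dj .
  qed
  also have "\<dots> = u * (- ((1 - x) ^ 2 * E)) + c / P * (shifted_sum K x (Suc j) - D * shifted_sum K 1 (Suc j))"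
    unfolding rho E by (simp add: algebra_simps)
  finally have eq: "shifted_sum K x j - (\<Prod>i\<in>{j..<m}. rho i) * shifted_sum K 1 j
     = u * (- ((1 - x) ^ 2 * E)) + c / P * (shifted_sum K x (Suc j) - D * shifted_sum K 1 (Suc j))" .
  have "ord_ge z (2 + 2) (u * (- ((1 - x) ^ 2 * E)))"
    by (intro ord_ge_mult u ord_ge_minus ord_ge_mult_val[OF ord_one_minus_x_sq E(2)])
  moreover have "ord_ge z 4 (c / P * (shifted_sum K x (Suc j) - D * shifted_sum K 1 (Suc j)))"
    using step.IH by (intro ord_ge_val_mult[OF cP]) (simp add: D_def)
  ultimately show ?case unfolding eq by (intro ord_ge_add) simp_all
qed

end

section \<open>The congruences\<close>

text \<open>This and \<open>closed_form\<close> are the two sides of the first congruence multiplied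
  by \<open>1 - q\<close>, with \<open>K = M + 1\<close>.\<close>

definition truncated_sum :: "'a::field \<Rightarrow> nat \<Rightarrow> 'a" where
  "truncated_sum q K = (\<Sum>k<K. (1 - q ^ (8 * k + 1)) * qratio 1 q k ^ 4 * q ^ (2 * k))"

definition closed_form :: "'a::field \<Rightarrow> nat \<Rightarrow> 'a" where
  "closed_form q m = (1 - q ^ (4 * m + 1)) * (inverse q ^ m * qratio 2 q m)
     * (1 + ((1 - q ^ (4 * m + 1)) / (1 - q)) ^ 2 * Bsum (4 * m + 1) q)"

lemma Bsum_eq:
  fixes q :: "'a::field"
  assumes "q \<noteq> 1"
  shows "Bsum (4 * m + 1) q = (1 - q) ^ 2 * ((of_nat (4 * m + 1) ^ 2 - 1) / 24
     + (\<Sum>k = 1..m. q ^ (4 * k - 2) / (1 - q ^ (4 * k - 2)) ^ 2))"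
proof -
  have "q ^ l / qint q l ^ 2 = (1 - q) ^ 2 * (q ^ l / (1 - q ^ l) ^ 2)" for l
    by (simp add: qint_def power_divide mult_ac)
  then show ?thesis by (simp add: Bsum_def distrib_left sum_distrib_left mult_ac)
qed

lemma closed_form_eq:
  fixes q :: "'a::field"
  assumes "q \<noteq> 1"
  shows "closed_form q m = (1 - q ^ (4 * m + 1)) * (inverse q ^ m * qratio 2 q m)
     * (1 + (1 - q ^ (4 * m + 1)) ^ 2 * ((of_nat (4 * m + 1) ^ 2 - 1) / 24
          + (\<Sum>k = 1..m. q ^ (4 * k - 2) / (1 - q ^ (4 * k - 2)) ^ 2)))"
proof -
  have "(a / (1 - q)) ^ 2 * ((1 - q) ^ 2 * b) = a ^ 2 * b" for a b
    using assms by (simp add: power_divide)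
  then show ?thesis unfolding closed_form_def Bsum_eq[OF assms] by simp
qed

section \<open>The first congruence at an arbitrary root of unity\<close>

context root_of_unity_point
begin

lemma p_neq_1: "p \<noteq> 1"
  using p_power_eq_1_iff[of 1] by simp

lemma val_closed_form: "has_val z (closed_form p m) 0"
proof -
  define y where "y = 1 - p ^ (4 * m + 1)"
  have wn: "w ^ (4 * m + 1) = 1" unfolding order by (rule d_dvd)
  have y: "has_val z y 0" using val_one_minus[of "4 * m + 1"] unfolding wn y_def by simp
  \<comment> \<open>At a non-primitive root, single terms of \<open>B(n,q)\<close> can have double
    poles. The factor \<open>y^2\<close>, coming from \<open>[n]^2\<close>, removes them, as
    \<open>y\<close> vanishes wherever \<open>1 - p^l\<close> has its simple zero.\<close>
  have ratio: "\<exists>c. has_val z (y ^ 2 * (p ^ l / (1 - p ^ l) ^ 2)) c" if "l > 0" for l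
  proof -
    have "\<exists>c. has_val z (y / (1 - p ^ l)) c"
    proof (cases "d dvd l")
      case True
      then show ?thesis using val_one_minus_ratio[OF d_dvd True that] by (auto simp only: y_def)
    next
      case False
      then have "1 - w ^ l \<noteq> 0" using order[of l] by auto
      from has_val_divide[OF y val_one_minus this] show ?thesis by blast
    qed
    then obtain c where "has_val z (y / (1 - p ^ l)) c" by blast
    then have "has_val z (p ^ l * (y / (1 - p ^ l)) ^ 2) (w ^ l * c ^ 2)"
      by (intro has_val_mult has_val_power val_p)
    then show ?thesis by (auto simp: power_divide mult_ac)
  qed
  obtain c where c: "has_val z (y ^ 2 * (p ^ l / (1 - p ^ l) ^ 2)) (c l)" if "l > 0" for l
    using ratio by metis
  have "has_val z (\<Sum>k = 1..m. y ^ 2 * (p ^ (4 * k - 2) / (1 - p ^ (4 * k - 2)) ^ 2))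
      (\<Sum>k = 1..m. c (4 * k - 2))"
    by (intro has_val_sum c) auto
  moreover have "has_val z (y ^ 2 * ((of_nat (4 * m + 1) ^ 2 - 1) / 24))
     (0 ^ 2 * ((of_nat (4 * m + 1) ^ 2 - 1) / 24))"
    by (intro has_val_mult has_val_power has_val_divide has_val_diff has_val_of_nat has_val_1
        has_val_numeral y) simp
  ultimately have v1: "has_val z (1 + (y ^ 2 * ((of_nat (4 * m + 1) ^ 2 - 1) / 24)
       + (\<Sum>k = 1..m. y ^ 2 * (p ^ (4 * k - 2) / (1 - p ^ (4 * k - 2)) ^ 2))))
     (1 + (0 ^ 2 * ((of_nat (4 * m + 1) ^ 2 - 1) / 24) + (\<Sum>k = 1..m. c (4 * k - 2))))"
    by (intro has_val_add has_val_1)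
  obtain r where "has_val z (qratio 2 p m) r" using val_qratio by blast
  then have v2: "has_val z (y * (inverse p ^ m * qratio 2 p m)) (0 * (inverse w ^ m * r))"
    by (intro has_val_mult has_val_power has_val_inverse y val_p w_nonzero)
  show ?thesis
    using has_val_mult[OF v2 v1]
    unfolding closed_form_eq[OF p_neq_1] y_def[symmetric] distrib_left[of "y ^ 2"] sum_distrib_left
    by (simp only: mult_zero_left)
qed

lemma ord_truncated_sum_diff:
  assumes "K = m + 1 \<or> K = 4 * m + 1"
  shows "ord_ge z 1 (truncated_sum p K - closed_form p m)"
  using has_val_diff[OF val_truncated_sum[OF assms] val_closed_form]
  by (intro has_val_0_imp_ord_ge_1) (simp add: truncated_sum_def)

end

section \<open>The first congruence at a primitive root of unity\<close>

context primitive_root_point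
begin

lemma shifted_sum_0:
  assumes "b \<noteq> 0"
  shows "shifted_sum K b 0 = (\<Sum>k<K. (1 - p ^ (8 * k + 1)) * p ^ (2 * k) * (wpair p b k * wpair p x k))"
proof -
  have "p * (p ^ 4) ^ (2 * k) = p ^ (8 * k + 1)" for k
    by (simp flip: power_mult)
  moreover have "p ^ (4 * 0 + 1) = p" by simp
  ultimately show ?thesis
    by (simp only: shifted_sum_def mult.commute[of x p] vwp_eq_wpair[OF p_nonzero assms x_nonzero])
      (simp only: mult_ac)
qed

lemma shifted_sum_1_0: "shifted_sum K 1 0 = summable_sum K 0"
  unfolding shifted_sum_def summable_sum_def vwp_def by (simp add: mult_ac)

lemma ord_truncated_sum_diff_primitive:
  assumes "K = m + 1 \<or> K = 4 * m + 1"
  shows "ord_ge z 4 (truncated_sum p K - closed_form p m)"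
proof -
  have K: "m < K" "K \<le> 4 * m + 1" using assms by auto
  define F where "F = truncated_sum p K"
  define S where "S = shifted_sum K 1 0"
  define T where "T = shifted_sum K x 0"
  define D where "D = (\<Prod>i\<in>{0..<m}. rho i)"
  have "F - 2 * S + T = (\<Sum>k<K. (1 - p ^ (8 * k + 1)) * p ^ (2 * k) * (wpair p 1 k - wpair p x k) ^ 2)"
  proof -
    have "F = (\<Sum>k<K. (1 - p ^ (8 * k + 1)) * p ^ (2 * k) * wpair p 1 k ^ 2)"
      unfolding F_def truncated_sum_def wpair_1[OF p_nonzero] by (simp add: mult_ac flip: power_mult)
    then show ?thesis
      unfolding S_def T_def shifted_sum_0[OF one_neq_zero] shifted_sum_0[OF x_nonzero]
      by (simp add: sum_distrib_left power2_diff distrib_left right_diff_distrib sum.distrib sum_subtractf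
          power2_eq_square mult_ac)
  qed
  moreover have "ord_ge z 4 (\<Sum>k<K. (1 - p ^ (8 * k + 1)) * p ^ (2 * k) * (wpair p 1 k - wpair p x k) ^ 2)"
  proof (intro ord_ge_sum)
    fix k assume "k \<in> {..<K}"
    with K have "ord_ge z 2 (wpair p 1 k - wpair p x k)" using ord_wpair_diff[of k] by auto
    then have "ord_ge z 4 ((wpair p 1 k - wpair p x k) ^ 2)" using ord_ge_power[of z 2 _ 2] by simp
    then show "ord_ge z 4 ((1 - p ^ (8 * k + 1)) * p ^ (2 * k) * (wpair p 1 k - wpair p x k) ^ 2)"
      by (rule ord_ge_val_mult[OF has_val_mult[OF val_one_minus val_p_power]])
  qed
  ultimately have 1: "ord_ge z 4 (F - 2 * S + T)" by simp
  have 2: "ord_ge z 4 (T - D * S)"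
    using shifted_sum_compare[OF K(1), of 0] by (simp add: S_def T_def D_def)
  obtain E where E: "D = 1 + (1 - x) ^ 2 * E"
     "has_val z E (\<Sum>i\<in>{0..<m}. w ^ (4 * i + 4) / (1 - w ^ (4 * i + 4)) ^ 2)"
    using prod_rho_expand[of 0] by (auto simp: D_def)
  define B where "B = (of_nat (4 * m + 1) ^ 2 - 1) / 24
      + (\<Sum>k = 1..m. p ^ (4 * k - 2) / (1 - p ^ (4 * k - 2)) ^ 2)"
  have B: "has_val z B ((of_nat (4 * m + 1) ^ 2 - 1) / 24
      + (\<Sum>k = 1..m. w ^ (4 * k - 2) / (1 - w ^ (4 * k - 2)) ^ 2))"
    unfolding B_def
  proof (intro has_val_add has_val_sum has_val_divide has_val_power has_val_diff has_val_of_nat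
      has_val_1 has_val_numeral val_p)
    fix k assume "k \<in> {1..m}"
    then have "\<not> 4 * m + 1 dvd 4 * k - 2" by (intro nat_dvd_not_less) auto
    then show "(1 - w ^ (4 * k - 2)) ^ 2 \<noteq> 0" using order[of "4 * k - 2"] by auto
  qed simp
  \<comment> \<open>\<open>E\<close> comes from \<open>D\<close> and \<open>B\<close> from the
    closed form; their values at \<open>z\<close> cancel. This supplies the last missing order: 1
    from \<open>S\<close>, 2 from \<open>(1 - x)^2\<close> and 1 from \<open>E + B\<close>.\<close>
  have "has_val z (E + B) ((\<Sum>i\<in>{0..<m}. w ^ (4 * i + 4) / (1 - w ^ (4 * i + 4)) ^ 2)
     + ((of_nat (4 * m + 1) ^ 2 - 1) / 24
      + (\<Sum>k = 1..m. w ^ (4 * k - 2) / (1 - w ^ (4 * k - 2)) ^ 2)))"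
    by (intro has_val_add E B)
  also have "(\<Sum>i\<in>{0..<m}. w ^ (4 * i + 4) / (1 - w ^ (4 * i + 4)) ^ 2)
      = (\<Sum>k = 1..m. w ^ (4 * k) / (1 - w ^ (4 * k)) ^ 2)"
    by (rule sum.reindex_bij_witness[of _ "\<lambda>k. k - 1" Suc]) (auto simp: add.commute)
  also have "\<dots> + ((of_nat (4 * m + 1) ^ 2 - 1) / 24
      + (\<Sum>k = 1..m. w ^ (4 * k - 2) / (1 - w ^ (4 * k - 2)) ^ 2)) = 0"
    using sum_even_inverse_squares_roots_unity[OF order] by (simp add: add_ac) (simp add: field_simps)
  finally have EB: "ord_ge z 1 (E + B)" by (rule has_val_0_imp_ord_ge_1)
  have S: "S = (1 - x) * (inverse p ^ m * qratio 2 p m)"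
    using summable_sum_0[OF K(1)] by (simp add: S_def shifted_sum_1_0)
  obtain r where "has_val z (qratio 2 p m) r" using val_qratio by blast
  then have "has_val z (inverse p ^ m * qratio 2 p m) (inverse w ^ m * r)"
    by (intro has_val_mult has_val_power has_val_inverse val_p w_nonzero)
  then have "ord_ge z 1 S" unfolding S by (rule ord_ge_mult_val[OF ord_one_minus_x])
  then have "ord_ge z (1 + 2 + 1) (S * (1 - x) ^ 2 * (E + B))"
    by (intro ord_ge_mult ord_one_minus_x_sq EB)
  moreover have "1 + 2 + 1 = (4 :: nat)" by simp
  ultimately have 3: "ord_ge z 4 (S * (1 - x) ^ 2 * (E + B))" by (simp only:)
  have "closed_form p m = S * (1 + (1 - x) ^ 2 * B)"
    unfolding closed_form_eq[OF p_neq_1] S B_def x_def ..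
  then have "truncated_sum p K - closed_form p m
      = (F - 2 * S + T) - (T - D * S) - S * (1 - x) ^ 2 * (E + B)"
    unfolding F_def[symmetric] E by (simp add: algebra_simps)
  then show ?thesis using ord_ge_diff[OF ord_ge_diff[OF 1 2] 3] by simp
qed

end

lemma (in root_of_unity_point) ord_truncated_sum_diff_cases:
  assumes "K = m + 1 \<or> K = 4 * m + 1"
  shows "ord_ge z (if d = 4 * m + 1 then 4 else 1) (truncated_sum p K - closed_form p m)"
proof (cases "d = 4 * m + 1")
  case True
  then interpret P: primitive_root_point z w p e m
    by unfold_locales (use order d_gt_1 z_nonzero e_pos p_eq w_eq in auto)
  show ?thesis using P.ord_truncated_sum_diff_primitive[OF assms] True by simp
next
  case False
  then show ?thesis using ord_truncated_sum_diff[OF assms] by simp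
qed

lemma cis_root_unity_power_eq_1_iff:
  assumes "n > 0"
  shows "cis (2 * pi * real k / real n) ^ i = 1 \<longleftrightarrow> n dvd k * i"
proof
  assume "n dvd k * i"
  then obtain l where l: "k * i = n * l" ..
  have "cis (2 * pi * real k / real n) ^ i = cis (2 * pi * real (k * i) / real n)"
    unfolding Complex.DeMoivre by (simp add: mult_ac)
  also have "2 * pi * real (k * i) / real n = 2 * pi * real l" unfolding l using assms by simp
  also have "cis (2 * pi * real l) = 1" by (rule cis_multiple_2pi) simp
  finally show "cis (2 * pi * real k / real n) ^ i = 1" .
next
  assume "cis (2 * pi * real k / real n) ^ i = 1"
  then have "cos (real i * (2 * pi * real k / real n)) = 1"
    unfolding Complex.DeMoivre by (simp add: complex_eq_iff)
  then obtain l :: int where l: "real i * (2 * pi * real k / real n) = real_of_int l * 2 * pi"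
    unfolding cos_one_2pi_int by blast
  then have "real i * (2 * pi * real k / real n) * (real n / (2 * pi)) = real_of_int l * 2 * pi * (real n / (2 * pi))"
    by simp
  then have "real i * real k = real_of_int l * real n" using assms by simp
  then have "real_of_int (int (k * i)) = real_of_int (l * int n)" by (simp add: mult.commute)
  then have "int (k * i) = l * int n" by (simp only: of_int_eq_iff)
  then have "int n dvd int (k * i)" by simp
  then show "n dvd k * i" by (simp only: of_nat_dvd_iff)
qed

text \<open>Here \<open>d = n / gcd(k,n)\<close>. It is odd, so \<open>z\<close> and
  \<open>z^2\<close> have the same order and one \<open>d\<close> serves both bases \<open>q\<close>
  and \<open>q^2\<close>.\<close>

lemma root_of_unity_points:
  assumes k: "0 < k" "k < 4 * m + 1"
  defines "z \<equiv> cis (2 * pi * real k / real (4 * m + 1))"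
  obtains d where "root_of_unity_point z z qvar 1 d m" "root_of_unity_point z (z ^ 2) (qvar ^ 2) 2 d m"
    "d = 4 * m + 1 \<longleftrightarrow> coprime k (4 * m + 1)"
proof -
  define n where "n = 4 * m + 1"
  define g where "g = gcd k n"
  define d where "d = n div g"
  have n0: "n > 0" by (simp add: n_def)
  have g: "g > 0" using n0 by (simp add: g_def)
  have nd: "n = g * d" unfolding d_def g_def by simp
  have dn: "d dvd n" unfolding nd by simp
  obtain k' where k': "k = g * k'" "coprime k' d"
  proof -
    have "coprime (k div g) d" unfolding d_def g_def by (rule div_gcd_coprime) (use n0 in simp)
    moreover have "k = g * (k div g)" unfolding g_def by simp
    ultimately show ?thesis by (rule that[rotated])
  qed
  have ord: "z ^ i = 1 \<longleftrightarrow> d dvd i" for i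
  proof -
    have "z ^ i = 1 \<longleftrightarrow> g * d dvd g * (k' * i)"
      using cis_root_unity_power_eq_1_iff[OF n0, of k i]
      unfolding z_def n_def[symmetric] by (simp add: k'(1) mult.assoc flip: nd)
    also have "\<dots> \<longleftrightarrow> d dvd k' * i" using g by simp
    also have "\<dots> \<longleftrightarrow> d dvd i" using k'(2) by (simp add: coprime_dvd_mult_right_iff coprime_commute)
    finally show ?thesis .
  qed
  have "d \<noteq> 0" using nd n0 by auto
  moreover have "d \<noteq> 1"
  proof
    assume "d = 1"
    then have "g = n" using nd by simp
    then have "n dvd k" unfolding g_def by (metis gcd_dvd1)
    then show False using k by (auto simp: n_def dest: dvd_imp_le)
  qed
  ultimately have d1: "d > 1" by simp
  have odd: "odd d"
  proof
    assume "even d"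
    then have "even n" using dn by (rule dvd_trans)
    then show False by (simp add: n_def)
  qed
  have z0: "z \<noteq> 0" by (simp add: z_def)
  have ord2: "(z ^ 2) ^ i = 1 \<longleftrightarrow> d dvd i" for i
  proof -
    have "(z ^ 2) ^ i = 1 \<longleftrightarrow> d dvd 2 * i" unfolding power_mult[symmetric] ord ..
    also have "\<dots> \<longleftrightarrow> d dvd i"
      using odd by (simp add: coprime_dvd_mult_right_iff coprime_commute)
    finally show ?thesis .
  qed
  have dn': "d dvd 4 * m + 1" using dn by (simp only: n_def)
  show ?thesis
  proof (rule that)
    show "root_of_unity_point z z qvar 1 d m"
      by unfold_locales (use z0 ord d1 dn' in auto)
    show "root_of_unity_point z (z ^ 2) (qvar ^ 2) 2 d m"
      by unfold_locales (use z0 ord2 d1 dn' in auto)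
    have "d = n \<longleftrightarrow> g = 1" using nd n0 d1 by auto
    then show "d = 4 * m + 1 \<longleftrightarrow> coprime k (4 * m + 1)"
      by (simp only: g_def n_def coprime_iff_gcd_eq_1)
  qed
qed

text \<open>Expanding the square expresses \<open>L\<close> through \<open>E\<close> and the first
  sum in base \<open>p\<close>; \<open>well_poised_telescoping\<close> then eliminates
  \<open>E\<close>. The arbitrary \<open>C\<close> becomes the closed form later, so the error
  consists of a boundary term and a multiple of the error in the first congruence.\<close>

lemma squared_sum_diff:
  fixes q :: "'a::field" and K :: nat
  defines "p \<equiv> q ^ 2"
  defines "L \<equiv> (\<Sum>k<K. (1 - p ^ (8 * k + 1)) / (1 - p) * ((1 - q ^ (8 * k + 1)) / (1 - q)) ^ 2
                 * qratio 1 p k ^ 4 * inverse p ^ (2 * k))"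
  assumes q0: "q \<noteq> 0" and p: "\<And>k. p ^ (4 * k + 4) \<noteq> 1" "p \<noteq> 1" and p': "1 + p \<noteq> 0"
  shows "L + 2 * q / ((1 + p) * (1 - p)) * C
     = (p ^ 2 * ((qratio 1 p K * (1 - p ^ (4 * K))) ^ 4 * inverse p ^ (2 * K)))
         / ((1 - p) ^ 2 * (1 - q) ^ 2 * (1 + p))
       - 2 * q / ((1 + p) * (1 - p)) * (truncated_sum p K - C)"
proof -
  define t where "t = (\<lambda>k. (1 - p ^ (8 * k + 1)) * qratio 1 p k ^ 4)"
  define E where "E = (\<Sum>k<K. t k * (inverse p ^ (2 * k) + p ^ (6 * k + 1)))"
  define F where "F = truncated_sum p K"
  define T where "T = p ^ 2 * ((qratio 1 p K * (1 - p ^ (4 * K))) ^ 4 * inverse p ^ (2 * K))"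
  have p0: "p \<noteq> 0" using q0 by (simp add: p_def)
  have q1: "q \<noteq> 1" using p(2) by (auto simp: p_def)
  have F: "F = (\<Sum>k<K. t k * p ^ (2 * k))"
    by (simp add: F_def truncated_sum_def t_def)
  have sq: "(1 - q ^ (8 * k + 1)) ^ 2 * inverse p ^ (2 * k)
      = (inverse p ^ (2 * k) + p ^ (6 * k + 1)) - 2 * q * p ^ (2 * k)" for k
  proof -
    define s where "s = q ^ (4 * k)"
    have s: "s \<noteq> 0" "p ^ (2 * k) = s" "q ^ (8 * k + 1) = q * s ^ 2" "p ^ (6 * k + 1) = q ^ 2 * s ^ 3"
      using q0 by (simp_all add: s_def p_def mult.commute power_add flip: power_mult)
    show ?thesis
      unfolding power_inverse s using s(1) by (simp add: field_simps eval_nat_numeral)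
  qed
  have "L = (\<Sum>k<K. t k * ((1 - q ^ (8 * k + 1)) ^ 2 * inverse p ^ (2 * k)) / ((1 - p) * (1 - q) ^ 2))"
    unfolding L_def t_def by (intro sum.cong refl) (simp add: power_divide mult_ac)
  also have "\<dots> = (\<Sum>k<K. t k * (inverse p ^ (2 * k) + p ^ (6 * k + 1)) - 2 * q * (t k * p ^ (2 * k)))
       / ((1 - p) * (1 - q) ^ 2)"
    unfolding sq sum_divide_distrib by (intro sum.cong refl) (simp add: algebra_simps)
  also have "\<dots> = (E - 2 * q * F) / ((1 - p) * (1 - q) ^ 2)"
    unfolding E_def F sum_subtractf sum_distrib_left ..
  finally have L: "L = (E - 2 * q * F) / ((1 - p) * (1 - q) ^ 2)" .
  have "T = (1 - p) * (\<Sum>k<K. t k * ((1 + p) * (inverse p ^ (2 * k) + p ^ (6 * k + 1)) - 4 * p * p ^ (2 * k)))"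
    unfolding T_def t_def well_poised_telescoping[OF p0 p(1), symmetric] ..
  also have "(\<Sum>k<K. t k * ((1 + p) * (inverse p ^ (2 * k) + p ^ (6 * k + 1)) - 4 * p * p ^ (2 * k)))
      = (1 + p) * E - 4 * p * F"
    unfolding E_def F sum_distrib_left sum_subtractf[symmetric]
    by (intro sum.cong refl) (simp add: algebra_simps)
  finally have "T / (1 - p) = (1 + p) * E - 4 * p * F" using p(2) by simp
  then have T: "E = (T / (1 - p) + 4 * p * F) / (1 + p)" using p' by simp
  have "(T / (1 - p) + 4 * p * F) / (1 + p) - 2 * q * F
      = T / (1 - p) / (1 + p) - 2 * q * (1 - q) ^ 2 / (1 + p) * F"
  proof -
    \<comment> \<open>As \<open>p = q^2\<close>, the coefficient is
      \<open>4p - 2q(1 + p) = -2q(1 - q)^2\<close>; the square cancels the \<open>(1 - q)^2\<close>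
      in the denominator of \<open>L\<close>.\<close>
    have "4 * p * F - 2 * q * F * (1 + p) = - (2 * q * (1 - q) ^ 2 * F)"
      unfolding p_def by algebra
    then have "(4 * p * F) / (1 + p) - 2 * q * F = - (2 * q * (1 - q) ^ 2 * F) / (1 + p)"
      using p' by (metis diff_divide_distrib nonzero_mult_div_cancel_right)
    then show ?thesis by (simp add: add_divide_distrib)
  qed
  then have "L = (T / (1 - p) / (1 + p) - 2 * q * (1 - q) ^ 2 / (1 + p) * F) / ((1 - p) * (1 - q) ^ 2)"
    unfolding L T by simp
  also have "\<dots> = T / ((1 - p) ^ 2 * (1 - q) ^ 2 * (1 + p)) - 2 * q / ((1 + p) * (1 - p)) * F"
  proof -
    have "(1 - q) ^ 2 \<noteq> 0" using q1 by simp
    then show ?thesis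
      by (simp add: diff_divide_distrib power2_eq_square[of "1 - p"] mult_ac)
  qed
  finally show ?thesis unfolding T_def F_def by (simp add: right_diff_distrib)
qed

theorem theorem1:
  fixes n M :: nat
  assumes "n > 0" and "[n = 1] (mod 4)"
    and "M = (n - 1) div 4 \<or> M = n - 1"
  shows
    "ratfun_cong
       (\<Sum>k = 0..M. qint qvar (8 * k + 1)
          * (qpoch qvar (qvar ^ 4) k ^ 4 / qpoch (qvar ^ 4) (qvar ^ 4) k ^ 4)
          * qvar ^ (2 * k))
       (qpoch (qvar ^ 2) (qvar ^ 4) ((n - 1) div 4) / qpoch (qvar ^ 4) (qvar ^ 4) ((n - 1) div 4)
          * qint qvar n * qvar powi ((1 - int n) div 4)
          * (1 + qint qvar n ^ 2 * Bsum n qvar))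
       (qint [:0, 1:] n * cyclotomic n ^ 3)
   \<and> (n > 1 \<longrightarrow>
     ratfun_cong
       (\<Sum>k = 0..M. qint (qvar ^ 2) (8 * k + 1) * qint qvar (8 * k + 1) ^ 2
          * (qpoch (qvar ^ 2) (qvar ^ 8) k ^ 4 / qpoch (qvar ^ 8) (qvar ^ 8) k ^ 4)
          * qvar powi (- 4 * int k))
       (- (2 * qint (qvar ^ 2) n * qpoch (qvar ^ 4) (qvar ^ 8) ((n - 1) div 4)
            / ((1 + qvar ^ 2) * qpoch (qvar ^ 8) (qvar ^ 8) ((n - 1) div 4)))
          * qvar powi ((3 - int n) div 2)
          * (1 + qint (qvar ^ 2) n ^ 2 * Bsum n (qvar ^ 2)))
       (qint [:0, 1:] n * cyclotomic n ^ 3))"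
proof -
  obtain m where n: "n = 4 * m + 1"
  proof -
    have "n mod 4 = 1" using assms(2) by (simp add: cong_def)
    then have "n = 4 * (n div 4) + 1" by presburger
    then show ?thesis by (rule that)
  qed
  have m: "(4 * m + 1 - 1) div 4 = m" by simp
  have K: "Suc M = m + 1 \<or> Suc M = 4 * m + 1" using assms(3) unfolding n m by auto
  have sets: "{0..M} = {..<Suc M}" by auto
  let ?q = qvar
  let ?p = "qvar ^ 2"
  have q0: "?q \<noteq> 0" using has_val_nonzero[OF has_val_qvar[of 1]] by simp
  have lhs1: "(\<Sum>k = 0..M. qint ?q (8 * k + 1) * (qpoch ?q (?q ^ 4) k ^ 4 / qpoch (?q ^ 4) (?q ^ 4) k ^ 4)
          * ?q ^ (2 * k)) = truncated_sum ?q (Suc M) / (1 - ?q)"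
    unfolding truncated_sum_def sets sum_divide_distrib
    by (intro sum.cong refl) (simp add: qint_def qratio_def power_divide)
  have exp1: "?q powi ((1 - int (4 * m + 1)) div 4) = inverse ?q ^ m"
  proof -
    have "(1 - int (4 * m + 1)) div 4 = - int m" by presburger
    then show ?thesis by (simp only: power_int_minus power_int_of_nat power_inverse)
  qed
  have rhs1: "qpoch (?q ^ 2) (?q ^ 4) m / qpoch (?q ^ 4) (?q ^ 4) m
          * qint ?q (4 * m + 1) * ?q powi ((1 - int (4 * m + 1)) div 4)
          * (1 + qint ?q (4 * m + 1) ^ 2 * Bsum (4 * m + 1) ?q) = closed_form ?q m / (1 - ?q)"
    unfolding exp1 closed_form_def qint_def qratio_def
    by (simp only: times_divide_eq_right times_divide_eq_left divide_divide_eq_left mult_ac)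
  have p4: "qvar ^ 8 = ?p ^ 4" "qvar ^ 4 = ?p ^ 2" by (simp_all flip: power_mult)
  have lhs2: "(\<Sum>k = 0..M. qint ?p (8 * k + 1) * qint ?q (8 * k + 1) ^ 2
          * (qpoch ?p (?q ^ 8) k ^ 4 / qpoch (?q ^ 8) (?q ^ 8) k ^ 4) * ?q powi (- 4 * int k))
     = (\<Sum>k<Suc M. (1 - ?p ^ (8 * k + 1)) / (1 - ?p) * ((1 - ?q ^ (8 * k + 1)) / (1 - ?q)) ^ 2
                 * qratio 1 ?p k ^ 4 * inverse ?p ^ (2 * k))"
    unfolding sets
  proof (intro sum.cong refl)
    fix k
    have "?q powi (- 4 * int k) = inverse (?q ^ (4 * k))"
    proof -
      have "- 4 * int k = - int (4 * k)" by simp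
      then show ?thesis by (simp only: power_int_minus power_int_of_nat)
    qed
    also have "\<dots> = inverse ?p ^ (2 * k)" by (simp add: power_inverse flip: power_mult)
    finally have e: "?q powi (- 4 * int k) = inverse ?p ^ (2 * k)" .
    show "qint ?p (8 * k + 1) * qint ?q (8 * k + 1) ^ 2
          * (qpoch ?p (?q ^ 8) k ^ 4 / qpoch (?q ^ 8) (?q ^ 8) k ^ 4) * ?q powi (- 4 * int k)
      = (1 - ?p ^ (8 * k + 1)) / (1 - ?p) * ((1 - ?q ^ (8 * k + 1)) / (1 - ?q)) ^ 2
                 * qratio 1 ?p k ^ 4 * inverse ?p ^ (2 * k)"
      unfolding e unfolding p4(1) qint_def qratio_def power_divide power_one_right ..
  qed
  have exp2: "?q powi ((3 - int (4 * m + 1)) div 2) = ?q * inverse ?p ^ m"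
  proof -
    have "(3 - int (4 * m + 1)) div 2 = 1 + - int (2 * m)" by presburger
    then have "?q powi ((3 - int (4 * m + 1)) div 2) = ?q powi 1 * ?q powi (- int (2 * m))"
      using power_int_add[OF disjI1[OF q0], of 1 "- int (2 * m)"] by (simp only:)
    then show ?thesis
      by (simp only: power_int_minus power_int_of_nat power_int_1_right power_inverse power_mult)
  qed
  have rhs2: "- (2 * qint ?p (4 * m + 1) * qpoch (?q ^ 4) (?q ^ 8) m / ((1 + ?p) * qpoch (?q ^ 8) (?q ^ 8) m))
          * ?q powi ((3 - int (4 * m + 1)) div 2)
          * (1 + qint ?p (4 * m + 1) ^ 2 * Bsum (4 * m + 1) ?p)
     = - (2 * ?q / ((1 + ?p) * (1 - ?p)) * closed_form ?p m)"
    unfolding exp2 unfolding p4 closed_form_def qint_def qratio_def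
    by (simp only: mult_minus_left mult_minus_right times_divide_eq_right times_divide_eq_left
        divide_divide_eq_left mult_ac)
  show ?thesis
  proof (cases "m = 0")
    case True
    then have "M = 0" "n = 1" using K n by auto
    \<comment> \<open>For \<open>n = 1\<close> both sides of the first congruence are 1, and the
      second assertion is vacuous.\<close>
    have "qint ?q 1 = 1"
      using has_val_nonzero[OF has_val_diff[OF has_val_1 has_val_qvar[of 0]]] by (simp add: qint_def)
    then show ?thesis
      unfolding \<open>M = 0\<close> \<open>n = 1\<close> by (simp add: ratfun_cong_def Bsum_def)
  next
    case False
    then have n1: "4 * m + 1 > 1" by simp
    have local1: "ord_ge z (if coprime k (4 * m + 1) then 4 else 1)
         (truncated_sum ?q (Suc M) / (1 - ?q) - closed_form ?q m / (1 - ?q))"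
      and local2: "ord_ge z (if coprime k (4 * m + 1) then 4 else 1)
         ((\<Sum>k<Suc M. (1 - ?p ^ (8 * k + 1)) / (1 - ?p) * ((1 - ?q ^ (8 * k + 1)) / (1 - ?q)) ^ 2
                 * qratio 1 ?p k ^ 4 * inverse ?p ^ (2 * k))
          - - (2 * ?q / ((1 + ?p) * (1 - ?p)) * closed_form ?p m))"
      if k: "0 < k" "k < 4 * m + 1" and z: "z = cis (2 * pi * real k / real (4 * m + 1))" for k z
    proof -
      obtain d where d: "root_of_unity_point z z ?q 1 d m" "root_of_unity_point z (z ^ 2) ?p 2 d m"
        "d = 4 * m + 1 \<longleftrightarrow> coprime k (4 * m + 1)"
        using root_of_unity_points[OF k] unfolding z by blast
      interpret A: root_of_unity_point z z ?q 1 d m by (rule d)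
      interpret B: root_of_unity_point z "z ^ 2" ?p 2 d m by (rule d)
      define r where "r = (if coprime k (4 * m + 1) then 4 else 1 :: nat)"
      have r: "r = (if d = 4 * m + 1 then 4 else 1)" by (simp only: r_def d(3))
      have "has_val z (1 / (1 - ?q)) (1 / (1 - z))"
        using A.w_neq_1 by (intro has_val_divide has_val_diff has_val_1 has_val_qvar) simp
      from ord_ge_mult_val[OF A.ord_truncated_sum_diff_cases[OF K] this]
      show "ord_ge z (if coprime k (4 * m + 1) then 4 else 1)
         (truncated_sum ?q (Suc M) / (1 - ?q) - closed_form ?q m / (1 - ?q))"
        unfolding r_def[symmetric] r by (simp add: diff_divide_distrib)
      \<comment> \<open>The denominator \<open>1 + q^2\<close> must not vanish at \<open>z\<close>:
        otherwise the order \<open>d\<close> would divide 4, but 4 is invertible modulo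
        \<open>d\<close> and \<open>d > 1\<close>.\<close>
      have z2: "1 + z ^ 2 \<noteq> 0"
      proof
        assume "1 + z ^ 2 = 0"
        then have "z ^ 4 = 1" by algebra
        then have "d dvd 4 * 1" by (simp add: A.order)
        then have "d dvd 1" by (rule A.dvd_4_mult_imp_dvd)
        then show False using A.d_gt_1 by simp
      qed
      have vp: "has_val z (1 + ?p) (1 + z ^ 2)"
        by (intro has_val_add has_val_1 B.val_p)
      have vp': "has_val z (1 - ?p) (1 - z ^ 2)"
        by (intro has_val_diff has_val_1 B.val_p)
      have z2': "1 - z ^ 2 \<noteq> 0" using B.w_neq_1 by simp
      have z1: "1 - z \<noteq> 0" using A.w_neq_1 by simp
      \<comment> \<open>The boundary term of \<open>squared_sum_diff\<close>. It contains the fourth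
        power of a quantity of order 1, which suffices even at the primitive roots.\<close>
      define T where "T = ?p ^ 2 * ((qratio 1 ?p (Suc M) * (1 - ?p ^ (4 * Suc M))) ^ 4 * inverse ?p ^ (2 * Suc M))
         / ((1 - ?p) ^ 2 * (1 - ?q) ^ 2 * (1 + ?p))"
      have "ord_ge z 4 T"
      proof -
        have "has_val z (?p ^ 2 * inverse ?p ^ (2 * Suc M) / ((1 - ?p) ^ 2 * (1 - ?q) ^ 2 * (1 + ?p)))
           ((z ^ 2) ^ 2 * inverse (z ^ 2) ^ (2 * Suc M) / ((1 - z ^ 2) ^ 2 * (1 - z) ^ 2 * (1 + z ^ 2)))"
          using z1 z2 z2' B.w_nonzero
          by (intro has_val_divide has_val_mult has_val_power has_val_inverse vp vp' has_val_diff
              has_val_1 has_val_qvar) auto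
        from ord_ge_mult_val[OF ord_ge_power[OF B.ord_boundary[OF K], of 4] this]
        show ?thesis unfolding T_def by (simp add: mult_ac)
      qed
      then have T: "ord_ge z r T" by (rule ord_ge_mono) (simp add: r_def)
      have v: "has_val z (2 * ?q / ((1 + ?p) * (1 - ?p))) (2 * z / ((1 + z ^ 2) * (1 - z ^ 2)))"
        using z2 z2' by (intro has_val_divide has_val_mult has_val_numeral has_val_qvar vp vp') simp
      have D: "ord_ge z r (truncated_sum ?p (Suc M) - closed_form ?p m)"
        unfolding r by (rule B.ord_truncated_sum_diff_cases[OF K])
      have "1 + ?p \<noteq> 0" using has_val_nonzero[OF vp z2] .
      then have eq: "(\<Sum>k<Suc M. (1 - ?p ^ (8 * k + 1)) / (1 - ?p) * ((1 - ?q ^ (8 * k + 1)) / (1 - ?q)) ^ 2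
                 * qratio 1 ?p k ^ 4 * inverse ?p ^ (2 * k))
          - - (2 * ?q / ((1 + ?p) * (1 - ?p)) * closed_form ?p m)
         = T - 2 * ?q / ((1 + ?p) * (1 - ?p)) * (truncated_sum ?p (Suc M) - closed_form ?p m)"
        unfolding T_def diff_minus_eq_add
        by (intro squared_sum_diff q0 B.p_neq_1) (simp add: B.p_power_eq_1_iff)
      show "ord_ge z (if coprime k (4 * m + 1) then 4 else 1)
         ((\<Sum>k<Suc M. (1 - ?p ^ (8 * k + 1)) / (1 - ?p) * ((1 - ?q ^ (8 * k + 1)) / (1 - ?q)) ^ 2
                 * qratio 1 ?p k ^ 4 * inverse ?p ^ (2 * k))
          - - (2 * ?q / ((1 + ?p) * (1 - ?p)) * closed_form ?p m))"
        unfolding eq r_def[symmetric] by (intro ord_ge_diff T ord_ge_val_mult[OF v D])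
    qed
    show ?thesis
      unfolding n m lhs1 rhs1 lhs2 rhs2
      by (intro conjI impI ratfun_cong_local n1 local1 local2) auto
  qed
qed

end
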